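(* Let $(M,g)$ be an oriented 3-dimensional manifold with metric of signature $(+++)$ (set $s=1$) or $(++-)$ (set $s=-1$). Let $\mathrm{P}_{ab}$ be the Schouten tensor and $\mathrm{P}=g^{ab}\mathrm{P}_{ab}$ its trace. Assume that $$Q^b{}_d=\mathrm{P}_{ac}\mathrm{P}^{ac}\delta^b{}_d+\mathrm{P}\,\mathrm{P}^b{}_d-\tfrac32\mathrm{P}^{be}\mathrm{P}_{de}-\tfrac12\mathrm{P}^2\delta^b{}_d$$ has nowhere-zero determinant, with matrix inverse $\tilde Q^a{}_b$. Let $c_2,\lambda\in\mathbb{R}$. Then every 1-form $X_a$ satisfying $\nabla_{(a}X_{b)}-c_2R_{ab}=\lambda g_{ab}$ satisfies $$X^e\Big(\nabla_eR_{ac}-s\,(\nabla_eR_{fk})\,E_{(ca)d}\,\tilde Q^d{}_b\,E^{(fk)b}\Big)=S_{ac}-s\,E_{(ca)d}\,\tilde Q^d{}_b\,S_{fk}\,E^{(fk)b},$$ where $$S_{ac}=c_2\big(-R_c{}^eR_{ae}-R^b{}_c{}^e{}_aR_{be}\big)-2\lambda R_{ca}+c_2\big(\nabla_a\nabla^bR_{cb}-\nabla_a\nabla_cR\big)-c_2\big(\Delta R_{ca}-\nabla^b\nabla_cR_{ba}\big)$$ and $$E_{(cd)b}=\mathrm{P}^a{}_{(c}\epsilon_{d)ab}.$$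
   Context: Abstract index notation; $\nabla$ is the Levi-Civita connection, $\Delta=\nabla^a\nabla_a$, indices are raised and lowered with $g$, round brackets denote symmetrisation (with factor $\tfrac12$). $R_{ab}$ is the Ricci tensor, $R$ the scalar curvature; the Schouten tensor is defined by $R_{ab}=\mathrm{P}_{ab}+\mathrm{P}g_{ab}$, and the Riemann tensor convention is $R_{abcd}=g_{ac}\mathrm{P}_{bd}-g_{bc}\mathrm{P}_{ad}+g_{bd}\mathrm{P}_{ac}-g_{ad}\mathrm{P}_{bc}$ (so $g^{ac}R_{abcd}=R_{bd}$). The volume form $\epsilon_{abc}$ satisfies $\epsilon_{abc}\epsilon_{de}{}^c=s(g_{ad}g_{be}-g_{ae}g_{bd})$. *)

theory Defs
  imports "HOL-Analysis.Analysis"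
begin

section \<open>Oriented smooth 3-manifolds\<close>

definition pd :: "3 \<Rightarrow> (real^3 \<Rightarrow> real) \<Rightarrow> real^3 \<Rightarrow> real" where
  "pd i f x = frechet_derivative f (at x) (axis i 1)"

text \<open>Intended for open \<open>S\<close>: all partial derivatives up to order \<open>k\<close> exist and are continuous.\<close>

primrec Ck_on :: "nat \<Rightarrow> (real^3) set \<Rightarrow> (real^3 \<Rightarrow> real) \<Rightarrow> bool" where
  "Ck_on 0 S f \<longleftrightarrow> continuous_on S f"
| "Ck_on (Suc k) S f \<longleftrightarrow>
     (\<forall>x\<in>S. f differentiable (at x)) \<and> (\<forall>i. Ck_on k S (pd i f))"

definition smooth_on :: "(real^3) set \<Rightarrow> (real^3 \<Rightarrow> real) \<Rightarrow> bool" where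
  "smooth_on S f \<longleftrightarrow> (\<forall>k. Ck_on k S f)"

text \<open>A chart is a coordinate patch \<open>U\<close> together with a coordinate map, which is only
  relevant on \<open>U\<close>.\<close>

type_synonym 'a chart = "'a set \<times> ('a \<Rightarrow> real^3)"

definition coord_range :: "'a chart \<Rightarrow> (real^3) set" where
  "coord_range u = snd u ` fst u"

definition is_chart :: "'a topology \<Rightarrow> 'a chart \<Rightarrow> bool" where
  "is_chart M u \<longleftrightarrow> openin M (fst u) \<and> open (coord_range u) \<and>
     homeomorphic_map (subtopology M (fst u)) (top_of_set (coord_range u)) (snd u)"

definition transition :: "'a chart \<Rightarrow> 'a chart \<Rightarrow> real^3 \<Rightarrow> real^3" where
  "transition u v x = snd v (inv_into (fst u) (snd u) x)"

abbreviation overlap :: "'a chart \<Rightarrow> 'a chart \<Rightarrow> (real^3) set" where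
  "overlap u v \<equiv> snd u ` (fst u \<inter> fst v)"

definition oriented_3manifold :: "'a topology \<Rightarrow> 'a chart set \<Rightarrow> bool" where
  "oriented_3manifold M A \<longleftrightarrow>
     Hausdorff_space M \<and> second_countable M \<and>
     (\<forall>u\<in>A. is_chart M u) \<and> (\<Union>u\<in>A. fst u) = topspace M \<and>
     (\<forall>u\<in>A. \<forall>v\<in>A.
        (\<forall>i. smooth_on (overlap u v) (\<lambda>x. transition u v x $ i)) \<and>
        (\<forall>x\<in>overlap u v. det (jacobian (transition u v) (at x)) > 0))"

section \<open>Tensor fields\<close>

text \<open>A tensor field is given by its components in every chart of the atlas, as functions
  of the coordinates, related on overlaps by the tensor transformation law; note that
  \<open>jacobian (transition u v) (at x) $ i $ a\<close> is the partial derivative of the \<open>i\<close>-th coordinate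
  of \<open>v\<close> with respect to the \<open>a\<close>-th coordinate of \<open>u\<close>. Component functions take their indices
  first and the coordinate point last.\<close>

type_synonym tens1 = "3 \<Rightarrow> real^3 \<Rightarrow> real"
type_synonym tens2 = "3 \<Rightarrow> 3 \<Rightarrow> real^3 \<Rightarrow> real"
type_synonym tens3 = "3 \<Rightarrow> 3 \<Rightarrow> 3 \<Rightarrow> real^3 \<Rightarrow> real"
type_synonym tens4 = "3 \<Rightarrow> 3 \<Rightarrow> 3 \<Rightarrow> 3 \<Rightarrow> real^3 \<Rightarrow> real"

definition one_form :: "'a chart set \<Rightarrow> ('a chart \<Rightarrow> tens1) \<Rightarrow> bool" where
  "one_form A X \<longleftrightarrow>
     (\<forall>u\<in>A. \<forall>a. smooth_on (coord_range u) (X u a)) \<and>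
     (\<forall>u\<in>A. \<forall>v\<in>A. \<forall>x\<in>overlap u v. \<forall>a.
        X u a x = (\<Sum>i\<in>UNIV. jacobian (transition u v) (at x) $ i $ a * X v i (transition u v x)))"

definition covariant_2tensor :: "'a chart set \<Rightarrow> ('a chart \<Rightarrow> tens2) \<Rightarrow> bool" where
  "covariant_2tensor A T \<longleftrightarrow>
     (\<forall>u\<in>A. \<forall>a b. smooth_on (coord_range u) (T u a b)) \<and>
     (\<forall>u\<in>A. \<forall>v\<in>A. \<forall>x\<in>overlap u v. \<forall>a b.
        T u a b x = (\<Sum>i\<in>UNIV. \<Sum>j\<in>UNIV.
          jacobian (transition u v) (at x) $ i $ a * jacobian (transition u v) (at x) $ j $ b
          * T v i j (transition u v x)))"

definition mat_at :: "tens2 \<Rightarrow> real^3 \<Rightarrow> real^3^3" where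
  "mat_at T x = (\<chi> a b. T a b x)"

text \<open>The columns of \<open>B\<close> form an orthonormal frame with squared lengths \<open>1, 1, s\<close>. Thus
  \<open>s = 1\<close> is signature \<open>(+++)\<close> and \<open>s = -1\<close> is signature \<open>(++-)\<close>.\<close>

definition has_signature :: "real \<Rightarrow> real^3^3 \<Rightarrow> bool" where
  "has_signature s G \<longleftrightarrow> (\<exists>B::real^3^3. invertible B \<and>
     transpose B ** G ** B = vector [vector [1, 0, 0], vector [0, 1, 0], vector [0, 0, s]])"

definition metric :: "'a chart set \<Rightarrow> real \<Rightarrow> ('a chart \<Rightarrow> tens2) \<Rightarrow> bool" where
  "metric A s g \<longleftrightarrow> covariant_2tensor A g \<and>
     (\<forall>u\<in>A. \<forall>x\<in>coord_range u. (\<forall>a b. g u a b x = g u b a x) \<and> has_signature s (mat_at (g u) x))"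

section \<open>Levi-Civita connection and curvature in a chart\<close>

text \<open>From here on \<open>g\<close> denotes the components of the metric in one fixed chart.\<close>

definition ginv :: "tens2 \<Rightarrow> tens2" where
  "ginv g a b x = matrix_inv (mat_at g x) $ a $ b"

text \<open>\<open>christoffel g e a b\<close> has the upper index \<open>e\<close> first.\<close>

definition christoffel :: "tens2 \<Rightarrow> tens3" where
  "christoffel g e a b x = 1/2 * (\<Sum>f\<in>UNIV. ginv g e f x *
     (pd a (g b f) x + pd b (g a f) x - pd f (g a b) x))"

text \<open>In \<open>covd1 g X a b\<close>, and likewise for higher rank, the index \<open>a\<close> of the derivative
  comes first.\<close>

definition covd1 :: "tens2 \<Rightarrow> tens1 \<Rightarrow> tens2" where
  "covd1 g X a b x = pd a (X b) x - (\<Sum>e\<in>UNIV. christoffel g e a b x * X e x)"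

definition covd2 :: "tens2 \<Rightarrow> tens2 \<Rightarrow> tens3" where
  "covd2 g T a b c x = pd a (T b c) x
     - (\<Sum>e\<in>UNIV. christoffel g e a b x * T e c x)
     - (\<Sum>e\<in>UNIV. christoffel g e a c x * T b e x)"

definition covd3 :: "tens2 \<Rightarrow> tens3 \<Rightarrow> tens4" where
  "covd3 g T a b c d x = pd a (T b c d) x
     - (\<Sum>e\<in>UNIV. christoffel g e a b x * T e c d x)
     - (\<Sum>e\<in>UNIV. christoffel g e a c x * T b e d x)
     - (\<Sum>e\<in>UNIV. christoffel g e a d x * T b c e x)"

lemma levi_civita_unique:
  fixes \<Gamma> :: "3 \<Rightarrow> 3 \<Rightarrow> 3 \<Rightarrow> real"
  assumes inv: "invertible (mat_at g x)"
    and sx: "\<And>a b. g a b x = g b a x"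
    and sym: "\<And>a b c. pd c (g a b) x = pd c (g b a) x"
  shows "((\<forall>e a b. \<Gamma> e a b = \<Gamma> e b a) \<and>
          (\<forall>a b c. pd a (g b c) x
             - (\<Sum>e\<in>UNIV. \<Gamma> e a b * g e c x) - (\<Sum>e\<in>UNIV. \<Gamma> e a c * g b e x) = 0))
         \<longleftrightarrow> (\<forall>e a b. \<Gamma> e a b = christoffel g e a b x)"
proof -
  define L where "L c a b = (\<Sum>e\<in>UNIV. g c e x * \<Gamma> e a b)" for c a b
  define K where "K c a b = 1/2 * (pd a (g b c) x + pd b (g a c) x - pd c (g a b) x)" for c a b
  have gi: "matrix_inv (mat_at g x) ** mat_at g x = mat 1"
    and ig: "mat_at g x ** matrix_inv (mat_at g x) = mat 1"
    using someI_ex[OF inv[unfolded invertible_def]] unfolding matrix_inv_def by auto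
  have gie: "(\<Sum>f\<in>UNIV. ginv g e f x * g f h x) = (if e = h then 1 else 0)" for e h
    using arg_cong[OF gi, of "\<lambda>m. m $ e $ h"]
    by (simp add: matrix_matrix_mult_def mat_def ginv_def mat_at_def)
  have ige: "(\<Sum>f\<in>UNIV. g e f x * ginv g f h x) = (if e = h then 1 else 0)" for e h
    using arg_cong[OF ig, of "\<lambda>m. m $ e $ h"]
    by (simp add: matrix_matrix_mult_def mat_def ginv_def mat_at_def)
  have chr: "christoffel g e a b x = (\<Sum>f\<in>UNIV. ginv g e f x * K f a b)" for e a b
    unfolding christoffel_def K_def by (simp add: sum_distrib_left algebra_simps)
  have "(\<forall>e a b. \<Gamma> e a b = christoffel g e a b x) \<longleftrightarrow> (\<forall>c a b. L c a b = K c a b)"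
  proof
    assume h: "\<forall>e a b. \<Gamma> e a b = christoffel g e a b x"
    show "\<forall>c a b. L c a b = K c a b"
    proof (intro allI)
      fix c a b
      have "L c a b = (\<Sum>f\<in>UNIV. (\<Sum>e\<in>UNIV. g c e x * ginv g e f x) * K f a b)"
        unfolding L_def using h chr
        by (simp add: sum_distrib_left sum_distrib_right mult.assoc) (rule sum.swap)
      then show "L c a b = K c a b"
        by (simp add: ige if_distrib if_distribR cong: if_cong)
    qed
  next
    assume h: "\<forall>c a b. L c a b = K c a b"
    show "\<forall>e a b. \<Gamma> e a b = christoffel g e a b x"
    proof (intro allI)
      fix e a b
      have "christoffel g e a b x = (\<Sum>f\<in>UNIV. ginv g e f x * L f a b)"
        using h chr by simp
      also have "\<dots> = (\<Sum>h\<in>UNIV. (\<Sum>f\<in>UNIV. ginv g e f x * g f h x) * \<Gamma> h a b)"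
        unfolding L_def
        by (simp add: sum_distrib_left sum_distrib_right mult.assoc) (rule sum.swap)
      finally show "\<Gamma> e a b = christoffel g e a b x"
        by (simp add: gie if_distrib if_distribR cong: if_cong)
    qed
  qed
  moreover have "(\<forall>e a b. \<Gamma> e a b = \<Gamma> e b a) \<longleftrightarrow> (\<forall>c a b. L c a b = L c b a)"
  proof
    assume "\<forall>e a b. \<Gamma> e a b = \<Gamma> e b a"
    then show "\<forall>c a b. L c a b = L c b a"
      unfolding L_def by (intro allI sum.cong refl arg_cong2[where f = "(*)"]) blast
  next
    assume h: "\<forall>c a b. L c a b = L c b a"
    have "\<Gamma> e a b = (\<Sum>f\<in>UNIV. ginv g e f x * L f a b)" for e a b
    proof -
      have "(\<Sum>f\<in>UNIV. ginv g e f x * L f a b)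
          = (\<Sum>h\<in>UNIV. (\<Sum>f\<in>UNIV. ginv g e f x * g f h x) * \<Gamma> h a b)"
        unfolding L_def
        by (simp add: sum_distrib_left sum_distrib_right mult.assoc) (rule sum.swap)
      then show ?thesis
        by (simp add: gie if_distrib if_distribR cong: if_cong)
    qed
    then show "\<forall>e a b. \<Gamma> e a b = \<Gamma> e b a"
      using h by (intro allI) simp
  qed
  moreover have L1: "(\<Sum>e\<in>UNIV. \<Gamma> e a b * g e c x) = L c a b" for a b c
    unfolding L_def by (rule sum.cong[OF refl]) (metis mult.commute sx)
  moreover have L2: "(\<Sum>e\<in>UNIV. \<Gamma> e a c * g b e x) = L b a c" for a b c
    unfolding L_def by (rule sum.cong[OF refl]) (rule mult.commute)
  moreover have "(\<forall>c a b. L c a b = L c b a) \<and> (\<forall>a b c. pd a (g b c) x - L c a b - L b a c = 0)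
     \<longleftrightarrow> (\<forall>c a b. L c a b = K c a b)"
  proof
    assume h: "(\<forall>c a b. L c a b = L c b a) \<and> (\<forall>a b c. pd a (g b c) x - L c a b - L b a c = 0)"
    show "\<forall>c a b. L c a b = K c a b"
    proof (intro allI)
      fix c a b
      have D: "pd a (g b c) x = L c a b + L b a c" for a b c
        using conjunct2[OF h, rule_format, of a b c] by linarith
      have "L c b a = L c a b" "L b c a = L b a c" "L a c b = L a b c"
        using h by blast+
      then show "L c a b = K c a b"
        unfolding K_def D[of a b c] D[of b a c] D[of c a b] by simp
    qed
  next
    assume h: "\<forall>c a b. L c a b = K c a b"
    have "K c a b = K c b a" for a b c
      unfolding K_def by (simp add: sym[of _ a b])
    moreover have "pd a (g b c) x - K c a b - K b a c = 0" for a b c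
      unfolding K_def by (simp add: sym[of _ c b] field_simps)
    ultimately show "(\<forall>c a b. L c a b = L c b a) \<and> (\<forall>a b c. pd a (g b c) x - L c a b - L b a c = 0)"
      using h by simp
  qed
  ultimately show ?thesis
    unfolding L1 L2 by blast
qed

text \<open>\<open>riem_mixed g a b c d\<close> is \<open>R_ab^c_d\<close> with
  \<open>(\<nabla>_a \<nabla>_b - \<nabla>_b \<nabla>_a) Y^c = R_ab^c_d Y^d\<close>. This sign makes the Ricci tensor of the round sphere
  positive and agrees with
  \<open>R_abcd = g_ac P_bd - g_bc P_ad + g_bd P_ac - g_ad P_bc\<close>.\<close>

definition riem_mixed :: "tens2 \<Rightarrow> tens4" where
  "riem_mixed g a b c d x = pd a (christoffel g c b d) x - pd b (christoffel g c a d) x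
     + (\<Sum>e\<in>UNIV. christoffel g c a e x * christoffel g e b d x)
     - (\<Sum>e\<in>UNIV. christoffel g c b e x * christoffel g e a d x)"

definition riem :: "tens2 \<Rightarrow> tens4" where
  "riem g a b c d x = (\<Sum>e\<in>UNIV. g c e x * riem_mixed g a b e d x)"

definition ricci :: "tens2 \<Rightarrow> tens2" where
  "ricci g b d x = (\<Sum>a\<in>UNIV. \<Sum>c\<in>UNIV. ginv g a c x * riem g a b c d x)"

definition tr :: "tens2 \<Rightarrow> tens2 \<Rightarrow> real^3 \<Rightarrow> real" where
  "tr g T x = (\<Sum>a\<in>UNIV. \<Sum>b\<in>UNIV. ginv g a b x * T a b x)"

abbreviation scal :: "tens2 \<Rightarrow> real^3 \<Rightarrow> real" where
  "scal g \<equiv> tr g (ricci g)"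

text \<open>\<open>mixed g T a b\<close> is \<open>T^a_b\<close> and \<open>raised g T a b\<close> is \<open>T^ab\<close>.\<close>

definition mixed :: "tens2 \<Rightarrow> tens2 \<Rightarrow> tens2" where
  "mixed g T a b x = (\<Sum>e\<in>UNIV. ginv g a e x * T e b x)"

definition raised :: "tens2 \<Rightarrow> tens2 \<Rightarrow> tens2" where
  "raised g T a b x = (\<Sum>e\<in>UNIV. \<Sum>f\<in>UNIV. ginv g a e x * ginv g b f x * T e f x)"

text \<open>The Schouten tensor is the solution of \<open>R_ab = P_ab + P g_ab\<close> with \<open>P = g^ab P_ab\<close>.\<close>

definition schouten :: "tens2 \<Rightarrow> tens2" where
  "schouten g a b x = (THE P::real^3^3. \<forall>c d.
     ricci g c d x = P $ c $ d + (\<Sum>e\<in>UNIV. \<Sum>f\<in>UNIV. ginv g e f x * P $ e $ f) * g c d x) $ a $ b"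

lemma schouten_existence_unique:
  assumes inv: "invertible (mat_at g x)" and sym: "\<And>a b. g a b x = g b a x"
  shows "\<exists>!P::real^3^3. \<forall>c d.
     ricci g c d x = P $ c $ d + (\<Sum>e\<in>UNIV. \<Sum>f\<in>UNIV. ginv g e f x * P $ e $ f) * g c d x"
proof -
  let ?t = "\<lambda>P::real^3^3. \<Sum>e\<in>UNIV. \<Sum>f\<in>UNIV. ginv g e f x * P $ e $ f"
  have gi: "matrix_inv (mat_at g x) ** mat_at g x = mat 1"
    using someI_ex[OF inv[unfolded invertible_def]] unfolding matrix_inv_def by auto
  have "(\<Sum>f\<in>UNIV. ginv g e f x * g f e x) = 1" for e
    using arg_cong[OF gi, of "\<lambda>m. m $ e $ e"]
    by (simp add: matrix_matrix_mult_def mat_def ginv_def mat_at_def)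
  then have g3: "(\<Sum>e\<in>UNIV. \<Sum>f\<in>UNIV. ginv g e f x * g e f x) = 3"
    using sym by simp
  have t: "?t (\<chi> c d. ricci g c d x - q * g c d x) = scal g x - q * 3" for q
  proof -
    have "?t (\<chi> c d. ricci g c d x - q * g c d x)
        = scal g x - q * (\<Sum>e\<in>UNIV. \<Sum>f\<in>UNIV. ginv g e f x * g e f x)"
      by (simp add: tr_def right_diff_distrib sum_subtractf sum_distrib_left mult.left_commute)
    then show ?thesis using g3 by simp
  qed
  show ?thesis
  proof (rule ex1I[where a = "\<chi> c d. ricci g c d x - scal g x / 4 * g c d x"])
    show "\<forall>c d. ricci g c d x = (\<chi> c d. ricci g c d x - scal g x / 4 * g c d x) $ c $ d
        + ?t (\<chi> c d. ricci g c d x - scal g x / 4 * g c d x) * g c d x"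
      unfolding t by simp
  next
    fix P :: "real^3^3"
    assume P: "\<forall>c d. ricci g c d x = P $ c $ d + ?t P * g c d x"
    then have P': "P = (\<chi> c d. ricci g c d x - ?t P * g c d x)"
      by (simp add: vec_eq_iff)
    have "?t P = ?t (\<chi> c d. ricci g c d x - ?t P * g c d x)"
      by (rule arg_cong[where f = ?t, OF P'])
    then have P2: "?t P = scal g x / 4"
      unfolding t by simp
    show "P = (\<chi> c d. ricci g c d x - scal g x / 4 * g c d x)"
      by (rule P'[unfolded P2])
  qed
qed

section \<open>The volume form and the tensors E, Q and S\<close>

text \<open>The determinant of coordinate unit vectors is the permutation sign; the charts of the
  atlas are positively oriented.\<close>

definition volform :: "tens2 \<Rightarrow> tens3" where
  "volform g a b c x = sqrt \<bar>det (mat_at g x)\<bar> *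
     det (vector [axis a 1, axis b 1, axis c 1] :: real^3^3)"

text \<open>\<open>tensE g c d b\<close> is \<open>E_(cd)b\<close>, with symmetrisation over \<open>c, d\<close> included.\<close>

definition tensE :: "tens2 \<Rightarrow> tens3" where
  "tensE g c d b x = 1/2 *
     ((\<Sum>a\<in>UNIV. mixed g (schouten g) a c x * volform g d a b x)
    + (\<Sum>a\<in>UNIV. mixed g (schouten g) a d x * volform g c a b x))"

definition tensE_raised :: "tens2 \<Rightarrow> tens3" where
  "tensE_raised g c d b x = (\<Sum>i\<in>UNIV. \<Sum>j\<in>UNIV. \<Sum>k\<in>UNIV.
     ginv g c i x * ginv g d j x * ginv g b k x * tensE g i j k x)"

text \<open>\<open>tensQ g b d\<close> is \<open>Q^b_d\<close>, with \<open>b\<close> as row index of the matrix.\<close>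

definition tensQ :: "tens2 \<Rightarrow> tens2" where
  "tensQ g b d x =
     (\<Sum>a\<in>UNIV. \<Sum>c\<in>UNIV. schouten g a c x * raised g (schouten g) a c x) * of_bool (b = d)
     + tr g (schouten g) x * mixed g (schouten g) b d x
     - 3/2 * (\<Sum>e\<in>UNIV. raised g (schouten g) b e x * schouten g d e x)
     - 1/2 * (tr g (schouten g) x)\<^sup>2 * of_bool (b = d)"

definition tensQ_inv :: "tens2 \<Rightarrow> tens2" where
  "tensQ_inv g a b x = matrix_inv (mat_at (tensQ g) x) $ a $ b"

definition hess_scal :: "tens2 \<Rightarrow> tens2" where
  "hess_scal g = covd1 g (\<lambda>c. pd c (scal g))"

text \<open>\<open>DDric g a b c d\<close> is \<open>\<nabla>_a \<nabla>_b R_cd\<close>.\<close>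

definition DDric :: "tens2 \<Rightarrow> tens4" where
  "DDric g = covd3 g (covd2 g (ricci g))"

definition tensS :: "tens2 \<Rightarrow> real \<Rightarrow> real \<Rightarrow> tens2" where
  "tensS g c\<^sub>2 lam a c x =
     c\<^sub>2 * (- (\<Sum>e\<in>UNIV. \<Sum>f\<in>UNIV. ginv g e f x * ricci g c f x * ricci g a e x)
           - (\<Sum>b\<in>UNIV. \<Sum>e\<in>UNIV. \<Sum>p\<in>UNIV. \<Sum>q\<in>UNIV.
                ginv g b p x * ginv g e q x * riem g p c q a x * ricci g b e x))
     - 2 * lam * ricci g c a x
     + c\<^sub>2 * ((\<Sum>b\<in>UNIV. \<Sum>e\<in>UNIV. ginv g b e x * DDric g a e c b x) - hess_scal g a c x)
     - c\<^sub>2 * ((\<Sum>b\<in>UNIV. \<Sum>e\<in>UNIV. ginv g b e x * DDric g b e c a x)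
           - (\<Sum>b\<in>UNIV. \<Sum>e\<in>UNIV. ginv g b e x * DDric g e c b a x))"

end

theory Submission
  imports Defs
begin

text \<open>The claim is local, so it is proved in one coordinate chart. For an arbitrary one-form \<open>X\<close>, the
  Lie derivative of the Ricci tensor along \<open>X\<close> is the linearised Ricci tensor applied to the
  deformation \<open>\<nabla>_a X_b + \<nabla>_b X_a\<close> of the metric (\<open>lie_ricci\<close>). If \<open>\<nabla>_(a X_b) = c\<^sub>2 R_ab + \<lambda> g_ab\<close>,
  then the second derivatives of the deformation are second derivatives of the Ricci tensor alone.
  Writing \<open>\<nabla>_a X_b = c\<^sub>2 R_ab + \<lambda> g_ab + F_ab\<close> with \<open>F\<close> skew, the identity becomes
  \<open>X^e \<nabla>_e R_ac + R_ce F_a^e + R_ae F_c^e = S_ac\<close> (\<open>soliton_lie_ricci\<close>).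

  This still contains the unknown rotation \<open>F\<close>. In dimension three \<open>F\<close> is dual to a vector \<open>w\<close>,
  and the multiple of \<open>g\<close> in \<open>R_ab = P_ab + P g_ab\<close> drops out of the symmetrised rotation term,
  which is therefore \<open>E_(ca)d w^d\<close> after a rescaling of \<open>w\<close> (\<open>rotation_ricci\<close>). Expanding a product of two volume
  forms gives \<open>E_(fk)d E^(fk)b = s Q^b_d\<close> (\<open>tensE_contraction\<close>). Contracting the identity with
  \<open>E^(fk)b\<close> and applying the inverse of \<open>Q\<close> thus determines \<open>w\<close>, and substituting the result
  back removes \<open>F\<close> (\<open>eliminate_rotation\<close>).

  The geometric half rests on the Ricci identities for one-forms and 2-tensors, and on the contracted
  second Bianchi identity. The second Bianchi identity follows from the two Ricci identities: in the
  cyclic sum of the antisymmetrised third derivatives \<open>\<nabla>_a \<nabla>_b \<nabla>_c X_d\<close> one may commute either the outer or the inner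
  pair of derivatives, and the value of \<open>X\<close> at a point is arbitrary. All contractions are
  written with \<open>tr\<close>; the lemma \<open>pd_tr\<close>, which says that \<open>\<nabla>\<close> commutes with them, keeps the Christoffel
  symbols out of the later arguments.\<close>

section \<open>Partial derivatives and smooth functions\<close>

lemma pd_unique: "(f has_derivative f') (at x) \<Longrightarrow> pd i f x = f' (axis i 1)"
  unfolding pd_def using frechet_derivative_at by metis

lemma pd_const: "pd i (\<lambda>x. c) x = 0"
  by (rule pd_unique[where f' = "\<lambda>_. 0"]) simp

lemma pd_cong:
  assumes "open U" "x \<in> U" "\<And>y. y \<in> U \<Longrightarrow> f y = h y"
  shows "pd i f x = pd i h x"
proof -
  have "(f has_derivative F) (at x) \<longleftrightarrow> (h has_derivative F) (at x)" for F
    using has_derivative_transform_within_open[OF _ assms(1,2)] assms(3) by metis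
  then show ?thesis unfolding pd_def frechet_derivative_def by simp
qed

lemma pd_add:
  assumes "f differentiable (at x)" "h differentiable (at x)"
  shows "pd i (\<lambda>y. f y + h y) x = pd i f x + pd i h x"
  using pd_unique[OF has_derivative_add[OF assms[unfolded frechet_derivative_works]]]
  by (simp add: pd_def)

lemma pd_mult:
  assumes "f differentiable (at x)" "h differentiable (at x)"
  shows "pd i (\<lambda>y. f y * h y) x = pd i f x * h x + f x * pd i h x"
  using pd_unique[OF has_derivative_mult[OF assms[unfolded frechet_derivative_works]]]
  by (simp add: pd_def)

lemma pd_cmult:
  assumes "f differentiable (at x)"
  shows "pd i (\<lambda>y. c * f y) x = c * pd i f x"
  using pd_mult[OF differentiable_const assms] by (simp add: pd_const)

lemma pd_diff:
  assumes "f differentiable (at x)" "h differentiable (at x)"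
  shows "pd i (\<lambda>y. f y - h y) x = pd i f x - pd i h x"
  using pd_unique[OF has_derivative_diff[OF assms[unfolded frechet_derivative_works]]]
  by (simp add: pd_def)

lemma pd_sum:
  assumes "finite I" "\<And>k. k \<in> I \<Longrightarrow> f k differentiable (at x)"
  shows "pd i (\<lambda>y. \<Sum>k\<in>I. f k y) x = (\<Sum>k\<in>I. pd i (f k) x)"
  using assms by (induction I) (simp_all add: pd_const pd_add)

lemma pd_inverse:
  assumes "f differentiable (at x)" "f x \<noteq> 0"
  shows "pd i (\<lambda>y. inverse (f y)) x = - (pd i f x * (inverse (f x) * inverse (f x)))"
proof -
  have "((\<lambda>y. inverse (f y)) has_derivative
      (\<lambda>h. - (inverse (f x) * frechet_derivative f (at x) h * inverse (f x)))) (at x)"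
    using Deriv.has_derivative_inverse[where f = f, OF assms(2)] assms(1)[unfolded frechet_derivative_works]
    by blast
  from pd_unique[OF this] show ?thesis by (simp add: pd_def)
qed

lemma Ck_on_SucD: "Ck_on (Suc k) S f \<Longrightarrow> Ck_on k S f"
proof (induction k arbitrary: f)
  case 0
  then show ?case
    by (simp add: differentiable_imp_continuous_on differentiable_on_def differentiable_at_withinI)
next
  case (Suc k)
  have "f differentiable (at x)" if "x \<in> S" for x using Suc.prems that by simp
  moreover have "Ck_on k S (pd i f)" for i
    by (rule Suc.IH) (use Suc.prems in simp)
  ultimately show ?case unfolding Ck_on.simps(2) by blast
qed

lemma Ck_on_cong:
  assumes "open U" "\<And>y. y \<in> U \<Longrightarrow> f y = h y" "Ck_on k U f"
  shows "Ck_on k U h"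
  using assms(2,3)
proof (induction k arbitrary: f h)
  case 0
  then show ?case using continuous_on_cong by (metis Ck_on.simps(1))
next
  case (Suc k)
  have "h differentiable (at x)" if "x \<in> U" for x
  proof -
    have "f differentiable (at x)" using Suc.prems that by simp
    then show ?thesis
      using has_derivative_transform_within_open[where f = f and g = h, OF _ assms(1) that Suc.prems(1)]
      unfolding differentiable_def by blast
  qed
  moreover have "Ck_on k U (pd i h)" for i
  proof (rule Suc.IH)
    show "pd i f y = pd i h y" if "y \<in> U" for y
      using pd_cong[OF assms(1) that] Suc.prems(1) .
    show "Ck_on k U (pd i f)" using Suc.prems(2) by simp
  qed
  ultimately show ?case unfolding Ck_on.simps(2) by blast
qed

lemma Ck_on_const: "Ck_on k U (\<lambda>x. c)"
proof (induction k arbitrary: c)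
  case (Suc k)
  have "pd i (\<lambda>x. c) = (\<lambda>x. 0)" for i by (simp add: pd_const fun_eq_iff)
  then show ?case using Suc by simp
qed simp

lemma Ck_on_add:
  assumes "open U" "Ck_on k U f" "Ck_on k U h"
  shows "Ck_on k U (\<lambda>x. f x + h x)"
  using assms(2,3)
proof (induction k arbitrary: f h)
  case 0
  then show ?case by (simp add: continuous_on_add)
next
  case (Suc k)
  have "Ck_on k U (\<lambda>x. pd i f x + pd i h x)" for i using Suc by simp
  then have "Ck_on k U (pd i (\<lambda>x. f x + h x))" for i
    by (rule Ck_on_cong[OF assms(1), rotated]) (use Suc.prems in \<open>simp add: pd_add\<close>)
  then show ?case using Suc.prems by simp
qed

lemma Ck_on_mult:
  assumes "open U" "Ck_on k U f" "Ck_on k U h"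
  shows "Ck_on k U (\<lambda>x. f x * h x)"
  using assms(2,3)
proof (induction k arbitrary: f h)
  case 0
  then show ?case by (simp add: continuous_on_mult)
next
  case (Suc k)
  have "Ck_on k U (\<lambda>x. pd i f x * h x + f x * pd i h x)" for i
    using Suc.IH Suc.prems Ck_on_SucD[of k U] by (intro Ck_on_add assms(1)) auto
  then have "Ck_on k U (pd i (\<lambda>x. f x * h x))" for i
    by (rule Ck_on_cong[OF assms(1), rotated]) (use Suc.prems in \<open>simp add: pd_mult\<close>)
  then show ?case using Suc.prems by simp
qed

lemma Ck_on_inverse:
  assumes "open U" "Ck_on k U f" "\<And>x. x \<in> U \<Longrightarrow> f x \<noteq> 0"
  shows "Ck_on k U (\<lambda>x. inverse (f x))"
  using assms(2)
proof (induction k)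
  case 0
  then show ?case using assms(3) by (simp add: continuous_on_inverse)
next
  case (Suc k)
  have "Ck_on k U (\<lambda>x. -1 * (pd i f x * (inverse (f x) * inverse (f x))))" for i
    using Suc.IH Suc.prems Ck_on_SucD[of k U f] by (intro Ck_on_mult Ck_on_const assms(1)) auto
  then have "Ck_on k U (pd i (\<lambda>x. inverse (f x)))" for i
    by (rule Ck_on_cong[OF assms(1), rotated]) (use Suc.prems assms(3) in \<open>simp add: pd_inverse\<close>)
  then show ?case using Suc.prems assms(3) by simp
qed

lemma smooth_on_const: "smooth_on U (\<lambda>x. c)"
  by (simp add: smooth_on_def Ck_on_const)

lemma smooth_on_add: "open U \<Longrightarrow> smooth_on U f \<Longrightarrow> smooth_on U h \<Longrightarrow> smooth_on U (\<lambda>x. f x + h x)"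
  by (simp add: smooth_on_def Ck_on_add)

lemma smooth_on_mult: "open U \<Longrightarrow> smooth_on U f \<Longrightarrow> smooth_on U h \<Longrightarrow> smooth_on U (\<lambda>x. f x * h x)"
  by (simp add: smooth_on_def Ck_on_mult)

lemma smooth_on_diff:
  assumes "open U" "smooth_on U f" "smooth_on U h"
  shows "smooth_on U (\<lambda>x. f x - h x)"
  using smooth_on_add[OF assms(1,2) smooth_on_mult[OF assms(1) smooth_on_const[of _ "-1"] assms(3)]]
  by simp

lemma smooth_on_inverse:
  "open U \<Longrightarrow> smooth_on U f \<Longrightarrow> (\<And>x. x \<in> U \<Longrightarrow> f x \<noteq> 0) \<Longrightarrow> smooth_on U (\<lambda>x. inverse (f x))"
  by (simp add: smooth_on_def Ck_on_inverse)

lemma smooth_on_sum: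
  assumes "open U" "finite I" "\<And>k. k \<in> I \<Longrightarrow> smooth_on U (f k)"
  shows "smooth_on U (\<lambda>x. \<Sum>k\<in>I. f k x)"
  using assms(2,3) by (induction I) (simp_all add: smooth_on_const smooth_on_add assms(1))

lemma smooth_on_pd: "smooth_on U f \<Longrightarrow> smooth_on U (pd i f)"
  unfolding smooth_on_def by (meson Ck_on.simps(2))

lemma smooth_on_cong:
  "open U \<Longrightarrow> (\<And>y. y \<in> U \<Longrightarrow> f y = h y) \<Longrightarrow> smooth_on U f \<Longrightarrow> smooth_on U h"
  unfolding smooth_on_def using Ck_on_cong by blast

lemma smooth_on_differentiable: "smooth_on U f \<Longrightarrow> x \<in> U \<Longrightarrow> f differentiable (at x)"
  unfolding smooth_on_def by (meson Ck_on.simps(2))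

lemma smooth_on_continuous: "smooth_on U f \<Longrightarrow> continuous_on U f"
  unfolding smooth_on_def by (meson Ck_on.simps(1))

lemma has_real_derivative_pd_line:
  assumes "f differentiable (at (x + t *\<^sub>R axis i 1))"
  shows "((\<lambda>t. f (x + t *\<^sub>R axis i 1)) has_real_derivative pd i f (x + t *\<^sub>R axis i 1)) (at t)"
proof -
  let ?D = "frechet_derivative f (at (x + t *\<^sub>R axis i 1))"
  have f: "(f has_derivative ?D) (at (x + t *\<^sub>R axis i 1))"
    using assms frechet_derivative_works by blast
  have "((\<lambda>t. x + t *\<^sub>R axis i 1) has_derivative (\<lambda>h. h *\<^sub>R axis i 1)) (at t)"
    by (auto intro!: derivative_eq_intros)
  from has_derivative_compose[OF this f]
  have "((\<lambda>t. f (x + t *\<^sub>R axis i 1)) has_derivative (\<lambda>h. ?D (h *\<^sub>R axis i 1))) (at t)" .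
  moreover have "?D (h *\<^sub>R axis i 1) = pd i f (x + t *\<^sub>R axis i 1) * h" for h
    using linear_scale[OF has_derivative_linear[OF f]] by (simp add: pd_def)
  ultimately show ?thesis by (simp add: has_field_derivative_def)
qed

text \<open>The mean value theorem is applied twice, first in direction \<open>i\<close> to the difference of two
  parallel sides of a square, then in direction \<open>j\<close>. The left-hand side is symmetric in \<open>i\<close> and
  \<open>j\<close>, which gives the symmetry of second derivatives below.\<close>
lemma second_difference_eq_pd:
  fixes f :: "real^3 \<Rightarrow> real"
  assumes d0: "\<And>y. y \<in> ball x r \<Longrightarrow> f differentiable (at y)"
    and d1: "\<And>y. y \<in> ball x r \<Longrightarrow> pd i f differentiable (at y)"
    and h: "0 < h" "2 * h < r"
  shows "\<exists>y\<in>ball x r. f (x + h *\<^sub>R axis i 1 + h *\<^sub>R axis j 1) - f (x + h *\<^sub>R axis i 1)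
           - f (x + h *\<^sub>R axis j 1) + f x = h * h * pd j (pd i f) y"
proof -
  let ?p = "\<lambda>t u. x + t *\<^sub>R axis i 1 + u *\<^sub>R axis j 1 :: real^3"
  have inb: "?p t u \<in> ball x r" if "0 \<le> t" "t \<le> h" "0 \<le> u" "u \<le> h" for t u
  proof -
    have "norm (t *\<^sub>R axis i 1 + u *\<^sub>R axis j 1 :: real^3) \<le> t + u"
      using norm_triangle_ineq[of "t *\<^sub>R axis i 1" "u *\<^sub>R axis j 1 :: real^3"] that
      by (simp add: norm_axis_1)
    then have "norm (t *\<^sub>R axis i 1 + u *\<^sub>R axis j 1 :: real^3) < r" using that h by linarith
    moreover have "x - ?p t u = - (t *\<^sub>R axis i 1 + u *\<^sub>R axis j 1)" by simp
    ultimately show ?thesis by (simp only: mem_ball dist_norm norm_minus_cancel)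
  qed
  have D1: "((\<lambda>t. f (?p t u)) has_real_derivative pd i f (?p t u)) (at t)"
    if "0 \<le> t" "t \<le> h" "0 \<le> u" "u \<le> h" for t u
    using has_real_derivative_pd_line[of f "x + u *\<^sub>R axis j 1" t i] d0[OF inb[OF that]]
    by (simp add: add.commute add.left_commute)
  have D2: "((\<lambda>u. pd i f (?p t u)) has_real_derivative pd j (pd i f) (?p t u)) (at u)"
    if "0 \<le> t" "t \<le> h" "0 \<le> u" "u \<le> h" for t u
    using has_real_derivative_pd_line[of "pd i f" "x + t *\<^sub>R axis i 1" u j] d1[OF inb[OF that]]
    by simp
  have "((\<lambda>t. f (?p t h) - f (?p t 0)) has_real_derivative pd i f (?p t h) - pd i f (?p t 0)) (at t)"
    if "0 \<le> t" "t \<le> h" for t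
    using DERIV_diff[OF D1[of t h] D1[of t 0]] that h by simp
  from MVT2[of 0 h, OF h(1) this] obtain t where t: "0 < t" "t < h"
    and et: "f (?p h h) - f (?p h 0) - (f (?p 0 h) - f (?p 0 0))
       = h * (pd i f (?p t h) - pd i f (?p t 0))" by auto
  from MVT2[of 0 h "\<lambda>u. pd i f (?p t u)" "\<lambda>u. pd j (pd i f) (?p t u)", OF h(1)] D2[of t] t
  obtain u where u: "0 < u" "u < h"
    and eu: "pd i f (?p t h) - pd i f (?p t 0) = h * pd j (pd i f) (?p t u)" by auto
  have "?p t u \<in> ball x r" using inb t u by simp
  then show ?thesis using et eu by (intro bexI[of _ "?p t u"]) simp_all
qed

text \<open>If the two mixed derivatives differed at \<open>x\<close>, then by continuity their ranges on a small ball
  would be disjoint. But both take the value of the same second difference quotient on that ball.\<close>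
lemma pd_commute:
  assumes U: "open U" "x \<in> U" and f: "smooth_on U f"
  shows "pd i (pd j f) x = pd j (pd i f) x"
proof (rule ccontr)
  assume ne: "pd i (pd j f) x \<noteq> pd j (pd i f) x"
  define e where "e = \<bar>pd i (pd j f) x - pd j (pd i f) x\<bar> / 2"
  have e: "e > 0" using ne by (simp add: e_def)
  have c: "continuous_on U (pd i (pd j f))" "continuous_on U (pd j (pd i f))"
    using f by (auto intro!: smooth_on_continuous smooth_on_pd)
  obtain r0 where r0: "r0 > 0" "ball x r0 \<subseteq> U" using U openE by blast
  obtain r1 where r1: "r1 > 0" "\<And>y. y \<in> U \<Longrightarrow> dist y x < r1 \<Longrightarrow>
      dist (pd i (pd j f) y) (pd i (pd j f) x) < e"
    using c(1) U(2) e unfolding continuous_on_iff by metis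
  obtain r2 where r2: "r2 > 0" "\<And>y. y \<in> U \<Longrightarrow> dist y x < r2 \<Longrightarrow>
      dist (pd j (pd i f) y) (pd j (pd i f) x) < e"
    using c(2) U(2) e unfolding continuous_on_iff by metis
  define r where "r = min r0 (min r1 r2)"
  have r: "r > 0" "ball x r \<subseteq> U" using r0 r1 r2 by (auto simp: r_def)
  have dif: "f differentiable (at y)" "pd i f differentiable (at y)" "pd j f differentiable (at y)"
    if "y \<in> ball x r" for y
    using that r f by (auto intro!: smooth_on_differentiable[of U] smooth_on_pd)
  have h: "0 < r / 3" "2 * (r / 3) < r" using r by auto
  obtain y where y: "y \<in> ball x r" and ey: "f (x + (r/3) *\<^sub>R axis i 1 + (r/3) *\<^sub>R axis j 1)
      - f (x + (r/3) *\<^sub>R axis i 1) - f (x + (r/3) *\<^sub>R axis j 1) + f x = r/3 * (r/3) * pd j (pd i f) y"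
    using second_difference_eq_pd[where f = f and i = i and j = j and x = x and r = r, OF dif(1,2) h] by blast
  obtain z where z: "z \<in> ball x r" and ez: "f (x + (r/3) *\<^sub>R axis j 1 + (r/3) *\<^sub>R axis i 1)
      - f (x + (r/3) *\<^sub>R axis j 1) - f (x + (r/3) *\<^sub>R axis i 1) + f x = r/3 * (r/3) * pd i (pd j f) z"
    using second_difference_eq_pd[where f = f and i = j and j = i and x = x and r = r, OF dif(1,3) h] by blast
  have "r/3 * (r/3) * pd j (pd i f) y = r/3 * (r/3) * pd i (pd j f) z"
    unfolding ey[symmetric] ez[symmetric] by (simp add: algebra_simps)
  then have "pd j (pd i f) y = pd i (pd j f) z" using r(1) by simp
  moreover have "\<bar>pd j (pd i f) y - pd j (pd i f) x\<bar> < e"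
    using r2(2)[of y] y r(2) by (auto simp: r_def dist_real_def dist_commute)
  moreover have "\<bar>pd i (pd j f) z - pd i (pd j f) x\<bar> < e"
    using r1(2)[of z] z r(2) by (auto simp: r_def dist_real_def dist_commute)
  ultimately show False by (simp add: e_def abs_if split: if_splits)
qed

section \<open>Contraction with the inverse metric\<close>

lemma tr_cong: "(\<And>a b. S a b x = T a b x) \<Longrightarrow> tr g S x = tr g T x"
  by (simp add: tr_def)

lemma tr_add: "tr g (\<lambda>a b y. S a b y + T a b y) x = tr g S x + tr g T x"
  by (simp add: tr_def distrib_left sum.distrib)

lemma tr_diff: "tr g (\<lambda>a b y. S a b y - T a b y) x = tr g S x - tr g T x"
  by (simp add: tr_def right_diff_distrib sum_subtractf)

lemma tr_uminus: "tr g (\<lambda>a b y. - T a b y) x = - tr g T x"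
  by (simp add: tr_def sum_negf)

lemma tr_cmult: "tr g (\<lambda>a b y. r y * T a b y) x = r x * tr g T x"
  by (simp add: tr_def sum_distrib_left mult.left_commute)

lemma tr_multc: "tr g (\<lambda>a b y. T a b y * r y) x = tr g T x * r x"
  by (simp add: tr_def sum_distrib_right mult.assoc)

lemma tr_tr_commute:
  "tr g (\<lambda>a b. tr g (\<lambda>c d. T a b c d)) x = tr g (\<lambda>c d. tr g (\<lambda>a b. T a b c d)) x"
  by (simp add: tr_def sum_3 algebra_simps)

text \<open>Cramer's rule makes the entries of the inverse metric quotients of polynomials in the entries
  of the metric, hence smooth.\<close>
lemma matrix_inv_entry:
  fixes M :: "real^3^3"
  assumes "det M \<noteq> 0"
  shows "matrix_inv M $ k $ j = det (\<chi> a b. if b = k then axis j 1 $ a else M $ a $ b) / det M"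
proof -
  have "M ** matrix_inv M = mat 1"
    using assms someI_ex[of "\<lambda>A. M ** A = mat 1 \<and> A ** M = mat 1"]
    by (simp add: invertible_det_nz[symmetric] invertible_def matrix_inv_def)
  then have "M *v (matrix_inv M *v axis j 1) = axis j 1"
    by (simp add: matrix_vector_mul_assoc)
  then have "matrix_inv M *v axis j 1
      = (\<chi> k. det (\<chi> a b. if b = k then axis j 1 $ a else M $ a $ b) / det M)"
    using cramer[OF assms] by blast
  moreover have "(matrix_inv M *v axis j 1) $ k = matrix_inv M $ k $ j"
    by (simp add: matrix_vector_mult_basis column_def)
  ultimately show ?thesis by simp
qed

lemma smooth_on_det:
  fixes F :: tens2
  assumes "open U" "\<And>a b. smooth_on U (F a b)"
  shows "smooth_on U (\<lambda>x. det (\<chi> a b. F a b x))"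
  unfolding det_3 using assms
  by (auto intro!: smooth_on_add smooth_on_diff smooth_on_mult)

section \<open>Metric, connection and curvature in a chart\<close>

definition covd4 :: "tens2 \<Rightarrow> tens4 \<Rightarrow> 3 \<Rightarrow> tens4" where
  "covd4 g T a b c d e x = pd a (T b c d e) x
     - (\<Sum>h\<in>UNIV. christoffel g h a b x * T h c d e x)
     - (\<Sum>h\<in>UNIV. christoffel g h a c x * T b h d e x)
     - (\<Sum>h\<in>UNIV. christoffel g h a d x * T b c h e x)
     - (\<Sum>h\<in>UNIV. christoffel g h a e x * T b c d h x)"

text \<open>One chart of the manifold, as seen in coordinates: a nondegenerate symmetric smooth matrix field
  on an open set.\<close>
locale chart_metric =
  fixes U :: "(real^3) set" and g :: tens2
  assumes open_U: "open U"
    and smooth_g: "\<And>a b. smooth_on U (g a b)"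
    and sym_g: "\<And>a b x. x \<in> U \<Longrightarrow> g a b x = g b a x"
    and inv_g: "\<And>x. x \<in> U \<Longrightarrow> invertible (mat_at g x)"
begin

lemma ginv_g: "x \<in> U \<Longrightarrow> (\<Sum>f\<in>UNIV. ginv g e f x * g f h x) = (if e = h then 1 else 0)"
  and g_ginv: "x \<in> U \<Longrightarrow> (\<Sum>f\<in>UNIV. g e f x * ginv g f h x) = (if e = h then 1 else 0)"
proof -
  assume "x \<in> U"
  then have "matrix_inv (mat_at g x) ** mat_at g x = mat 1"
    "mat_at g x ** matrix_inv (mat_at g x) = mat 1"
    using someI_ex[OF inv_g[unfolded invertible_def]] unfolding matrix_inv_def by auto
  from arg_cong[OF this(1), of "\<lambda>m. m $ e $ h"] arg_cong[OF this(2), of "\<lambda>m. m $ e $ h"]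
  show "(\<Sum>f\<in>UNIV. ginv g e f x * g f h x) = (if e = h then 1 else 0)"
    and "(\<Sum>f\<in>UNIV. g e f x * ginv g f h x) = (if e = h then 1 else 0)"
    by (simp_all add: matrix_matrix_mult_def mat_def ginv_def mat_at_def)
qed

lemma contract_g_ginv:
  assumes x: "x \<in> U"
  shows "(\<Sum>h\<in>UNIV. (\<Sum>f\<in>UNIV. a f * g f h x) * ginv g h k x) = a k"
proof -
  have "(\<Sum>h\<in>UNIV. (\<Sum>f\<in>UNIV. a f * g f h x) * ginv g h k x)
      = (\<Sum>f\<in>UNIV. a f * (\<Sum>h\<in>UNIV. g f h x * ginv g h k x))"
    by (simp add: sum_3 algebra_simps)
  then show ?thesis by (simp add: g_ginv[OF x] if_distrib cong: if_cong)
qed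

lemma ginv_sym: assumes x: "x \<in> U" shows "ginv g a b x = ginv g b a x"
proof -
  have "(\<Sum>f\<in>UNIV. ginv g f b x * g f h x) = (if h = b then 1 else 0)" for h
    using g_ginv[OF x, of h b] by (simp add: sym_g[OF x, of _ h] mult.commute)
  then have "ginv g a b x = (\<Sum>h\<in>UNIV. (if h = b then 1 else 0) * ginv g h a x)"
    using contract_g_ginv[OF x, of "\<lambda>f. ginv g f b x" a] by simp
  then show ?thesis by (simp add: if_distrib if_distribR cong: if_cong)
qed

lemma smooth_ginv: "smooth_on U (ginv g a b)"
proof -
  have nz: "det (mat_at g x) \<noteq> 0" if "x \<in> U" for x
    using inv_g[OF that] by (simp add: invertible_det_nz)
  have "smooth_on U (\<lambda>x. if j = a then axis b 1 $ i else g i j x)" for i j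
    by (cases "j = a") (simp_all add: smooth_g smooth_on_const)
  then have "smooth_on U (\<lambda>x. det (\<chi> i j. if j = a then axis b 1 $ i else g i j x)
      * inverse (det (\<chi> i j. g i j x)))"
    using nz unfolding mat_at_def
    by (intro smooth_on_mult smooth_on_inverse smooth_on_det open_U) (simp_all add: smooth_g)
  then show ?thesis
    by (rule smooth_on_cong[OF open_U, rotated])
      (use nz in \<open>simp add: ginv_def matrix_inv_entry divide_inverse mat_at_def cong: if_cong\<close>)
qed

lemmas smooth_intros = smooth_on_add smooth_on_diff smooth_on_mult smooth_on_sum smooth_on_const
  smooth_on_pd open_U smooth_g smooth_ginv finite_class.finite_UNIV

lemma smooth_christoffel: "smooth_on U (christoffel g e a b)"
  unfolding christoffel_def[abs_def] by (intro smooth_intros)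

lemma smooth_riem_mixed: "smooth_on U (riem_mixed g a b c d)"
  unfolding riem_mixed_def[abs_def] by (intro smooth_intros smooth_christoffel)

lemma smooth_riem: "smooth_on U (riem g a b c d)"
  unfolding riem_def[abs_def] by (intro smooth_intros smooth_riem_mixed)

lemma smooth_tr:
  assumes "\<And>a b. smooth_on U (T a b)"
  shows "smooth_on U (tr g T)"
  unfolding tr_def[abs_def] by (intro smooth_intros assms)

lemma ricci_eq_tr: "ricci g b d = tr g (\<lambda>a c. riem g a b c d)"
  by (simp add: fun_eq_iff ricci_def tr_def)

lemma smooth_ricci: "smooth_on U (ricci g a b)"
  unfolding ricci_eq_tr by (intro smooth_tr smooth_riem)

lemma smooth_covd1:
  assumes "\<And>a. smooth_on U (X a)"
  shows "smooth_on U (covd1 g X a b)"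
  unfolding covd1_def[abs_def] by (intro smooth_intros smooth_christoffel assms)

lemma smooth_covd2:
  assumes "\<And>a b. smooth_on U (T a b)"
  shows "smooth_on U (covd2 g T a b c)"
  unfolding covd2_def[abs_def] by (intro smooth_intros smooth_christoffel assms)

lemmas smooths = smooth_intros
  smooth_christoffel smooth_riem_mixed smooth_riem smooth_tr smooth_ricci smooth_covd1 smooth_covd2

lemma pd_sym_g: "x \<in> U \<Longrightarrow> pd c (g a b) x = pd c (g b a) x"
  using pd_cong[OF open_U] sym_g by metis

lemma christoffel_sym: "x \<in> U \<Longrightarrow> christoffel g e a b x = christoffel g e b a x"
  and pd_g: "x \<in> U \<Longrightarrow> pd a (g b c) x = (\<Sum>e\<in>UNIV. christoffel g e a b x * g e c x)
       + (\<Sum>e\<in>UNIV. christoffel g e a c x * g b e x)"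
  using levi_civita_unique[of g x "\<lambda>e a b. christoffel g e a b x", OF inv_g sym_g pd_sym_g]
  by (simp_all add: algebra_simps)

lemma differentiable_tens:
  assumes "x \<in> U"
  shows "g a b differentiable (at x)" "ginv g a b differentiable (at x)"
    "christoffel g e a b differentiable (at x)" "riem g a b c d differentiable (at x)"
    "riem_mixed g a b c d differentiable (at x)"
    "ricci g a b differentiable (at x)"
  using assms by (auto intro!: smooth_on_differentiable smooths)

text \<open>The covariant derivative of the inverse metric vanishes; obtained by differentiating
  \<open>g^ef g_fh = \<delta>^e_h\<close> and using metric compatibility.\<close>
lemma pd_ginv:
  assumes x: "x \<in> U"
  shows "pd d (ginv g e k) x = - (\<Sum>f\<in>UNIV. christoffel g e d f x * ginv g f k x)
           - (\<Sum>f\<in>UNIV. christoffel g k d f x * ginv g e f x)"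
proof -
  note [simp] = differentiable_tens[OF x]
  have z: "(\<Sum>f\<in>UNIV. pd d (ginv g e f) x * g f h x + ginv g e f x * pd d (g f h) x) = 0" for h
  proof -
    have "pd d (\<lambda>y. \<Sum>f\<in>UNIV. ginv g e f y * g f h y) x = pd d (\<lambda>y. if e = h then 1 else 0) x"
      by (rule pd_cong[OF open_U x]) (simp add: ginv_g)
    then show ?thesis by (simp add: pd_const pd_sum pd_mult)
  qed
  note c1 = contract_g_ginv[OF x]
  have c2: "(\<Sum>f\<in>UNIV. ginv g e f x * g f h x) = (if e = h then 1 else 0)" for h
    by (rule ginv_g[OF x])
  have "pd d (ginv g e k) x = (\<Sum>h\<in>UNIV. (\<Sum>f\<in>UNIV. pd d (ginv g e f) x * g f h x) * ginv g h k x)"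
    by (rule c1[symmetric])
  also have "\<dots> = - (\<Sum>h\<in>UNIV. (\<Sum>f\<in>UNIV. ginv g e f x * pd d (g f h) x) * ginv g h k x)"
  proof -
    have "(\<Sum>f\<in>UNIV. pd d (ginv g e f) x * g f h x) = - (\<Sum>f\<in>UNIV. ginv g e f x * pd d (g f h) x)" for h
      using z[of h] by (simp add: sum.distrib)
    then show ?thesis by (simp add: sum_negf)
  qed
  also have "\<dots> = - (\<Sum>h\<in>UNIV. (\<Sum>m\<in>UNIV. (\<Sum>f\<in>UNIV. ginv g e f x * christoffel g m d f x) * g m h x) * ginv g h k x)
     - (\<Sum>h\<in>UNIV. (\<Sum>m\<in>UNIV. (\<Sum>f\<in>UNIV. ginv g e f x * g f m x) * christoffel g m d h x) * ginv g h k x)"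
    unfolding pd_g[OF x] by (simp add: sum_3 algebra_simps)
  also have "\<dots> = - (\<Sum>f\<in>UNIV. ginv g e f x * christoffel g k d f x)
     - (\<Sum>h\<in>UNIV. christoffel g e d h x * ginv g h k x)"
    unfolding c1 c2 by (simp add: if_distrib if_distribR cong: if_cong)
  finally show ?thesis by (simp add: mult.commute)
qed

lemma tr_flip: "x \<in> U \<Longrightarrow> tr g (\<lambda>a b. T b a) x = tr g T x"
  unfolding tr_def by (subst sum.swap) (simp add: ginv_sym)

text \<open>Covariant differentiation commutes with contraction. Further indices of the tensor are
  spectators: their Christoffel terms pass through the contraction by linearity, so this one case
  serves for tensors of every rank.\<close>
lemma pd_tr:
  assumes x: "x \<in> U" and T: "\<And>a b. T a b differentiable (at x)"
  shows "pd d (tr g T) x = tr g (covd2 g T d) x"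
proof -
  note [simp] = differentiable_tens[OF x] T
  have "pd d (tr g T) x = (\<Sum>a\<in>UNIV. \<Sum>b\<in>UNIV. pd d (ginv g a b) x * T a b x + ginv g a b x * pd d (T a b) x)"
    unfolding tr_def[abs_def] by (simp add: pd_sum pd_mult)
  also have "\<dots> = tr g (covd2 g T d) x"
    unfolding pd_ginv[OF x] tr_def covd2_def by (simp add: sum_3 algebra_simps)
  finally show ?thesis .
qed

lemma raise_riem:
  assumes x: "x \<in> U"
  shows "(\<Sum>e\<in>UNIV. ginv g f e x * riem g a b e c x) = riem_mixed g a b f c x"
proof -
  have "(\<Sum>e\<in>UNIV. ginv g f e x * riem g a b e c x)
      = (\<Sum>h\<in>UNIV. (\<Sum>e\<in>UNIV. ginv g f e x * g e h x) * riem_mixed g a b h c x)"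
    unfolding riem_def by (simp add: sum_3 algebra_simps)
  then show ?thesis by (simp add: ginv_g[OF x] if_distrib if_distribR cong: if_cong)
qed

lemma tr_riem_mult:
  assumes x: "x \<in> U"
  shows "tr g (\<lambda>e f y. riem g a b e c y * X f y) x = (\<Sum>f\<in>UNIV. riem_mixed g a b f c x * X f x)"
proof -
  have "tr g (\<lambda>e f y. riem g a b e c y * X f y) x
      = (\<Sum>f\<in>UNIV. (\<Sum>e\<in>UNIV. ginv g e f x * riem g a b e c x) * X f x)"
    unfolding tr_def by (simp add: sum_3 algebra_simps)
  then show ?thesis using raise_riem[OF x] by (simp add: ginv_sym[OF x])
qed

section \<open>The Ricci identities and the symmetries of the curvature\<close>

lemma pd_covd1:
  assumes x: "x \<in> U" and X: "\<And>a. smooth_on U (X a)"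
  shows "pd a (covd1 g X b c) x = pd a (pd b (X c)) x
     - (\<Sum>e\<in>UNIV. pd a (christoffel g e b c) x * X e x + christoffel g e b c x * pd a (X e) x)"
proof -
  note [simp] = differentiable_tens[OF x] smooth_on_differentiable[OF X x]
    smooth_on_differentiable[OF smooth_on_pd[OF X] x]
  show ?thesis
    unfolding covd1_def[abs_def] by (simp add: pd_diff pd_sum pd_mult)
qed

lemma ricci_identity_covector:
  assumes x: "x \<in> U" and X: "\<And>a. smooth_on U (X a)"
  shows "covd2 g (covd1 g X) a b c x - covd2 g (covd1 g X) b a c x
     = - tr g (\<lambda>e f y. riem g a b e c y * X f y) x"
  unfolding tr_riem_mult[OF x] covd2_def pd_covd1[OF x X] riem_mixed_def
    pd_commute[OF open_U x X, of a b] christoffel_sym[OF x, of _ b a]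
  by (simp add: covd1_def sum_3 algebra_simps)

lemma pd_covd2:
  assumes x: "x \<in> U" and T: "\<And>a b. smooth_on U (T a b)"
  shows "pd d (covd2 g T a b c) x = pd d (pd a (T b c)) x
     - (\<Sum>e\<in>UNIV. pd d (christoffel g e a b) x * T e c x + christoffel g e a b x * pd d (T e c) x)
     - (\<Sum>e\<in>UNIV. pd d (christoffel g e a c) x * T b e x + christoffel g e a c x * pd d (T b e) x)"
proof -
  note [simp] = differentiable_tens[OF x] smooth_on_differentiable[OF T x]
    smooth_on_differentiable[OF smooth_on_pd[OF T] x]
  show ?thesis
    unfolding covd2_def[abs_def] by (simp add: pd_diff pd_sum pd_mult)
qed

lemma ricci_identity_2tensor:
  assumes x: "x \<in> U" and T: "\<And>a b. smooth_on U (T a b)"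
  shows "covd3 g (covd2 g T) d a b c x - covd3 g (covd2 g T) a d b c x
     = - tr g (\<lambda>e f y. riem g d a e b y * T f c y) x - tr g (\<lambda>e f y. riem g d a e c y * T b f y) x"
  unfolding tr_riem_mult[OF x, where X = "\<lambda>f. T f c"] tr_riem_mult[OF x, where X = "\<lambda>f. T b f"]
    covd3_def pd_covd2[OF x T] riem_mixed_def
    pd_commute[OF open_U x T, of a d] christoffel_sym[OF x, of _ d a]
  by (simp add: covd2_def sum_3 algebra_simps)

lemma riem_antisym_left: "riem g a b c d x = - riem g b a c d x"
  unfolding riem_def riem_mixed_def by (simp add: sum_3 algebra_simps)

lemma covd2_g: "x \<in> U \<Longrightarrow> covd2 g g a b c x = 0"
  unfolding covd2_def by (simp add: pd_g)

lemma lower_riem: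
  assumes x: "x \<in> U"
  shows "tr g (\<lambda>e f y. riem g a b e c y * g f d y) x = riem g a b d c x"
proof -
  have "riem g a b d c x = (\<Sum>f\<in>UNIV. riem_mixed g a b f c x * g f d x)"
    unfolding riem_def by (simp add: sym_g[OF x, of d] mult.commute)
  then show ?thesis using tr_riem_mult[OF x, where X = "\<lambda>f. g f d"] by simp
qed

text \<open>The Ricci identity for the 2-tensor \<open>g\<close>, whose covariant derivative is zero.\<close>
lemma riem_antisym_right:
  assumes x: "x \<in> U"
  shows "riem g a b c d x = - riem g a b d c x"
proof -
  have z: "covd3 g (covd2 g g) a b c d x = 0" for a b c d
  proof -
    have "pd a (covd2 g g b c d) x = pd a (\<lambda>_. 0) x"
      by (rule pd_cong[OF open_U x covd2_g])
    then show ?thesis unfolding covd3_def by (simp add: covd2_g[OF x] pd_const)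
  qed
  have "tr g (\<lambda>e f y. riem g a b e d y * g c f y) x = riem g a b c d x"
    unfolding lower_riem[OF x, symmetric] by (rule tr_cong) (simp add: sym_g[OF x, of c])
  then show ?thesis
    using ricci_identity_2tensor[where T = g and d = a and a = b and b = c and c = d, OF x smooth_g] z lower_riem[OF x]
    by simp
qed

lemma riem_bianchi1:
  assumes x: "x \<in> U"
  shows "riem g a b c d x + riem g b d c a x + riem g d a c b x = 0"
proof -
  have "riem_mixed g a b c d x + riem_mixed g b d c a x + riem_mixed g d a c b x = 0" for c
  proof -
    have "pd a (christoffel g c b d) x = pd a (christoffel g c d b) x" for a b d
      by (rule pd_cong[OF open_U x christoffel_sym])
    from this[of a b d] this[of b d a] this[of d a b] show ?thesis
      unfolding riem_mixed_def
      by (simp add: sum_3 christoffel_sym[OF x, of _ b a] christoffel_sym[OF x, of _ d a]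
        christoffel_sym[OF x, of _ d b])
  qed
  then have "(\<Sum>e\<in>UNIV. g c e x * (riem_mixed g a b e d x + riem_mixed g b d e a x + riem_mixed g d a e b x)) = 0"
    by simp
  then show ?thesis unfolding riem_def by (simp add: distrib_left sum.distrib)
qed

text \<open>The classical octahedron argument: four instances of the first Bianchi identity combined with
  the two skew symmetries.\<close>
lemma riem_pair_sym:
  assumes x: "x \<in> U"
  shows "riem g a b c d x = riem g c d a b x"
proof -
  note A = riem_antisym_left[of _ _ _ _ x] and B = riem_antisym_right[OF x] and C = riem_bianchi1[OF x]
  show ?thesis
    using C[of a b c d] C[of b c d a] C[of c d a b] C[of d a b c]
      A[of a b c d] A[of b c d a] A[of c d a b] A[of d a b c]
      A[of b d c a] A[of c a d b] A[of d b a c] A[of a c b d]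
      A[of d a c b] A[of a b d c] A[of b c a d] A[of c d b a]
      B[of a b c d] B[of b c d a] B[of c d a b] B[of d a b c]
      B[of b d c a] B[of c a d b] B[of d b a c] B[of a c b d]
      B[of b a c d] B[of c b d a] B[of d c a b] B[of a d b c]
    by linarith
qed

section \<open>Third derivatives of a one-form and the second Bianchi identity\<close>

lemma covd3_cong:
  assumes x: "x \<in> U" and "\<And>y a b c. y \<in> U \<Longrightarrow> S a b c y = T a b c y"
  shows "covd3 g S d a b c x = covd3 g T d a b c x"
proof -
  have "pd d (S a b c) x = pd d (T a b c) x" by (rule pd_cong[OF open_U x assms(2)])
  then show ?thesis using assms unfolding covd3_def by simp
qed

lemma covd3_diff:
  assumes x: "x \<in> U" and "\<And>a b c. S a b c differentiable (at x)" "\<And>a b c. T a b c differentiable (at x)"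
  shows "covd3 g (\<lambda>a b c y. S a b c y - T a b c y) d a b c x
     = covd3 g S d a b c x - covd3 g T d a b c x"
  unfolding covd3_def by (simp add: pd_diff assms right_diff_distrib sum_subtractf)

text \<open>The Leibniz rule for \<open>T_abec X^e\<close>, the form in which the curvature term of the Ricci identity
  for one-forms gets differentiated.\<close>
lemma covd3_tr_mult:
  assumes x: "x \<in> U" and T: "\<And>a b c d. T a b c d differentiable (at x)"
    and X: "\<And>a. X a differentiable (at x)"
  shows "covd3 g (\<lambda>a b c. tr g (\<lambda>e f y. T a b e c y * X f y)) d a b c x
     = tr g (\<lambda>e f y. covd4 g T d a b e c y * X f y) x
     + tr g (\<lambda>e f y. T a b e c y * covd1 g X d f y) x"
proof -
  note [simp] = differentiable_tens[OF x] T X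
  have 1: "pd d (tr g (\<lambda>e f y. T a b e c y * X f y)) x
     = tr g (\<lambda>e f y. pd d (T a b e c) y * X f y + T a b e c y * pd d (X f) y
         - (\<Sum>h\<in>UNIV. christoffel g h d e y * (T a b h c y * X f y))
         - (\<Sum>h\<in>UNIV. christoffel g h d f y * (T a b e c y * X h y))) x"
    unfolding pd_tr[OF x, where T = "\<lambda>e f y. T a b e c y * X f y", simplified]
    by (rule tr_cong) (simp add: covd2_def pd_mult)
  show ?thesis
    unfolding covd3_def 1 unfolding covd4_def[abs_def] covd1_def[abs_def] tr_def
    by (simp add: sum_3 algebra_simps)
qed

definition third_covd :: "tens1 \<Rightarrow> tens4" where
  "third_covd X = covd3 g (covd2 g (covd1 g X))"

lemma covd3_uminus:
  assumes "\<And>a b c. S a b c differentiable (at x)"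
  shows "covd3 g (\<lambda>a b c y. - S a b c y) d a b c x = - covd3 g S d a b c x"
  using pd_cmult[of "S _ _ _" x _ "-1", OF assms] unfolding covd3_def by (simp add: sum_negf)

text \<open>The covariant derivative of the Ricci identity for \<open>X\<close>; it brings in \<open>\<nabla>_d R_abec\<close>.\<close>
lemma third_covd_commute_inner:
  assumes x: "x \<in> U" and X: "\<And>a. smooth_on U (X a)"
  shows "third_covd X d a b c x - third_covd X d b a c x
    = - tr g (\<lambda>e f y. covd4 g (riem g) d a b e c y * X f y) x
      - tr g (\<lambda>e f y. riem g a b e c y * covd1 g X d f y) x"
proof -
  let ?V = "covd2 g (covd1 g X)"
  let ?R = "\<lambda>a b c. tr g (\<lambda>e f y. riem g a b e c y * X f y)"
  have dV: "?V a b c differentiable (at x)" for a b c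
    by (rule smooth_on_differentiable[OF _ x]) (intro smooths X)
  have dX: "X a differentiable (at x)" for a using smooth_on_differentiable[OF X x] .
  have dR: "?R a b c differentiable (at x)" for a b c
    by (rule smooth_on_differentiable[OF _ x]) (intro smooths X)
  have "third_covd X d a b c x - third_covd X d b a c x = covd3 g (\<lambda>a b c y. ?V a b c y - ?V b a c y) d a b c x"
    using covd3_diff[OF x dV dV, of "\<lambda>a b c. b" "\<lambda>a b c. a" "\<lambda>a b c. c"]
    unfolding third_covd_def covd3_diff[OF x dV dV] by (simp add: covd3_def)
  also have "\<dots> = covd3 g (\<lambda>a b c y. - ?R a b c y) d a b c x"
    by (rule covd3_cong[OF x]) (rule ricci_identity_covector[OF _ X])
  also have "\<dots> = - covd3 g ?R d a b c x"
    by (rule covd3_uminus) (rule dR)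
  finally show ?thesis
    unfolding covd3_tr_mult[OF x differentiable_tens(4)[OF x] dX] by simp
qed

text \<open>The Ricci identity for the 2-tensor \<open>\<nabla>_b X_c\<close>; no derivative of the curvature appears.\<close>
lemma third_covd_commute_outer:
  assumes x: "x \<in> U" and X: "\<And>a. smooth_on U (X a)"
  shows "third_covd X d a b c x - third_covd X a d b c x
     = - tr g (\<lambda>e f y. riem g d a e b y * covd1 g X f c y) x
       - tr g (\<lambda>e f y. riem g d a e c y * covd1 g X b f y) x"
  unfolding third_covd_def by (rule ricci_identity_2tensor[OF x]) (rule smooth_covd1[OF X])

lemma tr_g_slot:
  assumes x: "x \<in> U"
  shows "tr g (\<lambda>e f y. Z e y * g f k y) x = Z k x"
proof -
  have "tr g (\<lambda>e f y. Z e y * g f k y) x = (\<Sum>e\<in>UNIV. Z e x * (\<Sum>f\<in>UNIV. ginv g e f x * g f k x))"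
    by (simp add: tr_def sum_3 algebra_simps)
  then show ?thesis by (simp add: ginv_g[OF x] if_distrib cong: if_cong)
qed

text \<open>The cyclic sum over \<open>a, b, c\<close> of \<open>\<nabla>_a \<nabla>_b \<nabla>_c X_d - \<nabla>_a \<nabla>_c \<nabla>_b X_d\<close> is also the cyclic sum of
  \<open>\<nabla>_a \<nabla>_b \<nabla>_c X_d - \<nabla>_b \<nabla>_a \<nabla>_c X_d\<close>. Evaluating the first by \<open>third_covd_commute_inner\<close> and the second
  by \<open>third_covd_commute_outer\<close>, the terms with \<open>\<nabla>X\<close> cancel, using the first Bianchi identity. What
  remains is the second Bianchi identity contracted with \<open>X\<close>.\<close>
lemma riem_bianchi2:
  assumes x: "x \<in> U"
  shows "covd4 g (riem g) a b c e d x + covd4 g (riem g) b c a e d x + covd4 g (riem g) c a b e d x = 0"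
proof -
  \<comment> \<open>constant components, chosen so that raising the index at \<open>x\<close> gives the \<open>e\<close>-th coordinate vector\<close>
  define X :: tens1 where "X f y = g f e x" for f y
  have X: "smooth_on U (X f)" for f unfolding X_def[abs_def] by (rule smooth_on_const)
  let ?W = "third_covd X" and ?B = "covd1 g X"
  let ?Z = "\<lambda>a b c. tr g (\<lambda>e f y. covd4 g (riem g) a b c e d y * X f y) x"
  let ?P = "\<lambda>a b c. tr g (\<lambda>e f y. riem g b c e d y * ?B a f y) x"
  let ?Q = "\<lambda>a b c. tr g (\<lambda>e f y. riem g a b e c y * ?B f d y) x"
  have i: "?W a b c d x - ?W a c b d x = - ?Z a b c - ?P a b c" for a b c
    by (rule third_covd_commute_inner[OF x X])
  have o: "?W a b c d x - ?W b a c d x = - ?Q a b c - ?P c a b" for a b c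
    by (rule third_covd_commute_outer[OF x X])
  have cyc: "riem g a b e c x + riem g b c e a x + riem g c a e b x = 0" for e
    using riem_bianchi1[OF x, of a b e c] by simp
  have "?Q a b c + ?Q b c a + ?Q c a b
      = tr g (\<lambda>e f y. (riem g a b e c y + riem g b c e a y + riem g c a e b y) * ?B f d y) x"
    by (simp add: distrib_right tr_add)
  also have "\<dots> = tr g (\<lambda>e f y. 0) x" by (rule tr_cong) (simp add: cyc)
  finally have "?Q a b c + ?Q b c a + ?Q c a b = 0" by (simp add: tr_def)
  then have "?Z a b c + ?Z b c a + ?Z c a b = 0"
    using i[of a b c] i[of b c a] i[of c a b] o[of a b c] o[of b c a] o[of c a b] by linarith
  moreover have "?Z a b c = covd4 g (riem g) a b c e d x" for a b c
    unfolding tr_g_slot[OF x, of "\<lambda>e. covd4 g (riem g) a b c e d", symmetric]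
    by (rule tr_cong) (simp add: X_def)
  ultimately show ?thesis by simp
qed

lemma tr_covd4_riem_first_third:
  assumes x: "x \<in> U"
  shows "tr g (\<lambda>a c. covd4 g (riem g) e a b c d) x = covd2 g (ricci g) e b d x"
proof -
  note d = differentiable_tens(4)[OF x]
  have "pd e (ricci g b d) x = tr g (covd2 g (\<lambda>a c. riem g a b c d) e) x"
    unfolding ricci_eq_tr by (rule pd_tr[OF x d])
  then show ?thesis unfolding covd2_def[of g "ricci g"]
    by (simp add: ricci_eq_tr tr_def covd2_def covd4_def sum_3 algebra_simps)
qed

section \<open>The Lie derivative of the Ricci tensor\<close>

lemma covd4_riem_pair_sym:
  assumes x: "x \<in> U"
  shows "covd4 g (riem g) e a b c d x = covd4 g (riem g) e c d a b x"
proof -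
  have "pd e (riem g a b c d) x = pd e (riem g c d a b) x"
    by (rule pd_cong[OF open_U x riem_pair_sym])
  moreover have "riem g h b c d x = riem g c d h b x" "riem g a h c d x = riem g c d a h x"
    "riem g a b h d x = riem g h d a b x" "riem g a b c h x = riem g c h a b x" for h
    by (rule riem_pair_sym[OF x])+
  ultimately show ?thesis unfolding covd4_def by simp
qed

lemma covd4_riem_antisym_left:
  assumes x: "x \<in> U"
  shows "covd4 g (riem g) e a b c d x = - covd4 g (riem g) e b a c d x"
proof -
  have "pd e (riem g a b c d) x = pd e (\<lambda>y. -1 * riem g b a c d y) x"
    by (rule pd_cong[OF open_U x]) (simp add: riem_antisym_left[of a b])
  also have "\<dots> = -1 * pd e (riem g b a c d) x"
    by (rule pd_cmult) (rule differentiable_tens[OF x])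
  finally have "pd e (riem g a b c d) x = - pd e (riem g b a c d) x" by simp
  moreover have "riem g h b c d x = - riem g b h c d x" "riem g a h c d x = - riem g h a c d x"
    "riem g a b h d x = - riem g b a h d x" "riem g a b c h x = - riem g b a c h x" for h
    by (rule riem_antisym_left)+
  ultimately show ?thesis unfolding covd4_def by (simp only: sum_negf mult_minus_right)
qed

lemma covd4_riem_antisym_right:
  assumes x: "x \<in> U"
  shows "covd4 g (riem g) e a b c d x = - covd4 g (riem g) e a b d c x"
  unfolding covd4_riem_pair_sym[OF x, of e a b] by (rule covd4_riem_antisym_left[OF x])

lemma ricci_sym:
  assumes x: "x \<in> U"
  shows "ricci g a b x = ricci g b a x"
proof -
  have "ricci g a b x = tr g (\<lambda>e f. riem g f b e a) x"
    unfolding ricci_eq_tr by (rule tr_cong) (rule riem_pair_sym[OF x])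
  also have "\<dots> = ricci g b a x" unfolding ricci_eq_tr by (rule tr_flip[OF x])
  finally show ?thesis .
qed

lemma covd2_ricci_sym:
  assumes x: "x \<in> U"
  shows "covd2 g (ricci g) e a b x = covd2 g (ricci g) e b a x"
proof -
  have "pd e (ricci g a b) x = pd e (ricci g b a) x"
    by (rule pd_cong[OF open_U x ricci_sym])
  moreover have "ricci g h b x = ricci g b h x" "ricci g a h x = ricci g h a x" for h
    by (rule ricci_sym[OF x])+
  ultimately show ?thesis unfolding covd2_def by simp
qed

lemma DDric_sym:
  assumes x: "x \<in> U"
  shows "DDric g d e a b x = DDric g d e b a x"
proof -
  have "pd d (covd2 g (ricci g) e a b) x = pd d (covd2 g (ricci g) e b a) x"
    by (rule pd_cong[OF open_U x covd2_ricci_sym])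
  moreover have "covd2 g (ricci g) h a b x = covd2 g (ricci g) h b a x"
    "covd2 g (ricci g) e h b x = covd2 g (ricci g) e b h x"
    "covd2 g (ricci g) e a h x = covd2 g (ricci g) e h a x" for h
    by (rule covd2_ricci_sym[OF x])+
  ultimately show ?thesis unfolding DDric_def covd3_def by simp
qed

lemma tr_riem:
  assumes x: "x \<in> U"
  shows "tr g (\<lambda>c a. riem g a b d c) x = - ricci g b d x"
proof -
  have "tr g (\<lambda>a c. riem g a b d c) x = - ricci g b d x"
    unfolding ricci_eq_tr tr_uminus[symmetric] by (rule tr_cong) (rule riem_antisym_right[OF x])
  then show ?thesis using tr_flip[OF x, of "\<lambda>a c. riem g a b d c"] by simp
qed

lemma tr_covd4_riem:
  assumes x: "x \<in> U"
  shows "tr g (\<lambda>c a. covd4 g (riem g) e a b c d) x = covd2 g (ricci g) e b d x"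
    "tr g (\<lambda>c a. covd4 g (riem g) e a b d c) x = - covd2 g (ricci g) e b d x"
proof -
  show 1: "tr g (\<lambda>c a. covd4 g (riem g) e a b c d) x = covd2 g (ricci g) e b d x"
    unfolding tr_covd4_riem_first_third[OF x, symmetric] by (rule tr_flip[OF x])
  show "tr g (\<lambda>c a. covd4 g (riem g) e a b d c) x = - covd2 g (ricci g) e b d x"
    unfolding 1[symmetric] tr_uminus[symmetric]
    by (rule tr_cong) (rule covd4_riem_antisym_right[OF x])
qed

text \<open>The second Bianchi identity contracted once. The two equations differ by the pair of \<open>riem\<close>
  that contains the contracted index.\<close>
lemma div_riem:
  assumes x: "x \<in> U"
  shows "tr g (\<lambda>b d. covd4 g (riem g) d a b e c) x
      = covd2 g (ricci g) c e a x - covd2 g (ricci g) e c a x"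
    and "tr g (\<lambda>b d. covd4 g (riem g) d c a e b) x
      = covd2 g (ricci g) a c e x - covd2 g (ricci g) c a e x"
proof -
  have "tr g (\<lambda>b d. covd4 g (riem g) d a b e c) x
      = tr g (\<lambda>b d y. - covd4 g (riem g) e d c b a y + covd4 g (riem g) c d e b a y) x"
  proof (rule tr_cong)
    fix b d
    show "covd4 g (riem g) d a b e c x = - covd4 g (riem g) e d c b a x + covd4 g (riem g) c d e b a x"
      using riem_bianchi2[OF x, of d e c a b] covd4_riem_pair_sym[OF x, of d a b e c]
        covd4_riem_antisym_left[OF x, of e c d a b] covd4_riem_antisym_right[OF x, of e d c a b]
        covd4_riem_antisym_right[OF x, of c d e a b] by linarith
  qed
  then show "tr g (\<lambda>b d. covd4 g (riem g) d a b e c) x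
      = covd2 g (ricci g) c e a x - covd2 g (ricci g) e c a x"
    by (simp add: tr_diff tr_covd4_riem[OF x])
  have "tr g (\<lambda>b d. covd4 g (riem g) d c a e b) x
      = tr g (\<lambda>b d y. - covd4 g (riem g) c d a b e y + covd4 g (riem g) a d c b e y) x"
  proof (rule tr_cong)
    fix b d
    show "covd4 g (riem g) d c a e b x = - covd4 g (riem g) c d a b e x + covd4 g (riem g) a d c b e x"
      using riem_bianchi2[OF x, of d c a e b]
        covd4_riem_antisym_left[OF x, of c a d e b] covd4_riem_antisym_right[OF x, of c d a e b]
        covd4_riem_antisym_right[OF x, of a d c e b] by linarith
  qed
  then show "tr g (\<lambda>b d. covd4 g (riem g) d c a e b) x
      = covd2 g (ricci g) a c e x - covd2 g (ricci g) c a e x"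
    by (simp add: tr_diff tr_covd4_riem[OF x])
qed

lemma tr_contract_mult:
  "tr g (\<lambda>b d. tr g (\<lambda>e f y. T b d e y * X f y)) x = tr g (\<lambda>e f y. tr g (\<lambda>b d. T b d e) y * X f y) x"
  unfolding tr_tr_commute[where T = "\<lambda>b d e f y. T b d e y * X f y"]
  by (rule tr_cong) (simp add: tr_multc)

lemma tr_neg_sub:
  "tr g (\<lambda>b d y. - S b d y - T b d y) x = - tr g S x - tr g T x"
  by (simp add: tr_diff tr_uminus)

text \<open>Twice the Lie derivative of the Ricci tensor, expressed by the linearised curvature formula
  \<open>\<nabla>^b \<nabla>_a h_bc + \<nabla>^b \<nabla>_c h_ab - \<nabla>^b \<nabla>_b h_ac - \<nabla>_a \<nabla>_c h^b_b\<close> with \<open>h_ab = \<nabla>_a X_b + \<nabla>_b X_a\<close>. The eight third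
  derivatives are grouped, with intermediate orders inserted, into commutators. The derivatives of curvature then
  collapse by \<open>div_riem\<close> to \<open>2 \<nabla>_e R_ac X^e\<close>; the full curvature contracted with \<open>\<nabla>X\<close> cancels by
  the first Bianchi identity and only its traces survive.\<close>
lemma lie_ricci:
  assumes x: "x \<in> U" and X: "\<And>a. smooth_on U (X a)"
  shows "tr g (\<lambda>b d y. third_covd X d a b c y + third_covd X d a c b y + third_covd X d c a b y + third_covd X d c b a y
             - third_covd X d b a c y - third_covd X d b c a y - third_covd X a c b d y - third_covd X a c d b y) x
    = 2 * tr g (\<lambda>e f y. covd2 g (ricci g) e a c y * X f y) x
      + 2 * tr g (\<lambda>e f y. ricci g c e y * covd1 g X a f y) x
      + 2 * tr g (\<lambda>e f y. ricci g a e y * covd1 g X c f y) x"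
proof -
  let ?W = "third_covd X" and ?B = "covd1 g X" and ?D = "covd2 g (ricci g)"
  let ?DX = "\<lambda>p q r. tr g (\<lambda>e f y. ?D p q r y * X f y) x"
  define K1 where "K1 a c = tr g (\<lambda>b d. tr g (\<lambda>e f y. riem g a b e c y * ?B d f y)) x" for a c
  define K3 where "K3 = tr g (\<lambda>b d. tr g (\<lambda>e f y. riem g c a e b y * ?B d f y)) x"
  define K4 where "K4 = tr g (\<lambda>b d. tr g (\<lambda>e f y. riem g d a e c y * ?B f b y)) x"
  have P1: "tr g (\<lambda>b d y. ?W d a b c y - ?W d b a c y) x
      = - tr g (\<lambda>e f y. (?D c e a y - ?D e c a y) * X f y) x - K1 a c" for a c
  proof -
    have "tr g (\<lambda>b d y. ?W d a b c y - ?W d b a c y) x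
      = tr g (\<lambda>b d y. - tr g (\<lambda>e f y. covd4 g (riem g) d a b e c y * X f y) y
           - tr g (\<lambda>e f y. riem g a b e c y * ?B d f y) y) x"
      by (rule tr_cong) (rule third_covd_commute_inner[OF x X])
    also have "\<dots> = - tr g (\<lambda>b d. tr g (\<lambda>e f y. covd4 g (riem g) d a b e c y * X f y)) x - K1 a c"
      unfolding tr_neg_sub K1_def ..
    also have "tr g (\<lambda>b d. tr g (\<lambda>e f y. covd4 g (riem g) d a b e c y * X f y)) x
        = tr g (\<lambda>e f y. (?D c e a y - ?D e c a y) * X f y) x"
      unfolding tr_contract_mult by (rule tr_cong) (simp add: div_riem[OF x])
    finally show ?thesis .
  qed
  have P2: "tr g (\<lambda>b d y. ?W d c a b y - ?W d a c b y) x
      = - tr g (\<lambda>e f y. (?D a c e y - ?D c a e y) * X f y) x - K3"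
  proof -
    have "tr g (\<lambda>b d y. ?W d c a b y - ?W d a c b y) x
      = tr g (\<lambda>b d y. - tr g (\<lambda>e f y. covd4 g (riem g) d c a e b y * X f y) y
           - tr g (\<lambda>e f y. riem g c a e b y * ?B d f y) y) x"
      by (rule tr_cong) (rule third_covd_commute_inner[OF x X])
    also have "\<dots> = - tr g (\<lambda>b d. tr g (\<lambda>e f y. covd4 g (riem g) d c a e b y * X f y)) x - K3"
      unfolding tr_neg_sub K3_def ..
    also have "tr g (\<lambda>b d. tr g (\<lambda>e f y. covd4 g (riem g) d c a e b y * X f y)) x
        = tr g (\<lambda>e f y. (?D a c e y - ?D c a e y) * X f y) x"
      unfolding tr_contract_mult by (rule tr_cong) (simp add: div_riem[OF x])
    finally show ?thesis .
  qed
  have P3: "tr g (\<lambda>b d y. ?W d a c b y - ?W a d c b y) x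
      = - K4 + tr g (\<lambda>e f y. ricci g a e y * ?B c f y) x"
  proof -
    have "tr g (\<lambda>b d y. ?W d a c b y - ?W a d c b y) x
      = tr g (\<lambda>b d y. - tr g (\<lambda>e f y. riem g d a e c y * ?B f b y) y
           - tr g (\<lambda>e f y. riem g d a e b y * ?B c f y) y) x"
      by (rule tr_cong) (rule third_covd_commute_outer[OF x X])
    also have "\<dots> = - K4 - tr g (\<lambda>b d. tr g (\<lambda>e f y. riem g d a e b y * ?B c f y)) x"
      unfolding tr_neg_sub K4_def ..
    also have "tr g (\<lambda>b d. tr g (\<lambda>e f y. riem g d a e b y * ?B c f y)) x
        = tr g (\<lambda>e f y. - (ricci g a e y * ?B c f y)) x"
      unfolding tr_contract_mult by (rule tr_cong) (simp add: tr_riem[OF x])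
    finally show ?thesis by (simp add: tr_uminus)
  qed
  have P4: "tr g (\<lambda>b d y. ?W a d c b y - ?W a c d b y) x
      = tr g (\<lambda>e f y. ?D a c e y * X f y) x + tr g (\<lambda>e f y. ricci g c e y * ?B a f y) x"
  proof -
    have "tr g (\<lambda>b d y. ?W a d c b y - ?W a c d b y) x
      = tr g (\<lambda>b d y. - tr g (\<lambda>e f y. covd4 g (riem g) a d c e b y * X f y) y
           - tr g (\<lambda>e f y. riem g d c e b y * ?B a f y) y) x"
      by (rule tr_cong) (rule third_covd_commute_inner[OF x X])
    also have "\<dots> = - tr g (\<lambda>b d. tr g (\<lambda>e f y. covd4 g (riem g) a d c e b y * X f y)) x
        - tr g (\<lambda>b d. tr g (\<lambda>e f y. riem g d c e b y * ?B a f y)) x"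
      unfolding tr_neg_sub ..
    also have "tr g (\<lambda>b d. tr g (\<lambda>e f y. covd4 g (riem g) a d c e b y * X f y)) x
        = tr g (\<lambda>e f y. - (?D a c e y * X f y)) x"
      unfolding tr_contract_mult by (rule tr_cong) (simp add: tr_covd4_riem[OF x])
    also have "tr g (\<lambda>b d. tr g (\<lambda>e f y. riem g d c e b y * ?B a f y)) x
        = tr g (\<lambda>e f y. - (ricci g c e y * ?B a f y)) x"
      unfolding tr_contract_mult by (rule tr_cong) (simp add: tr_riem[OF x])
    finally show ?thesis by (simp add: tr_uminus)
  qed
  have P5: "tr g (\<lambda>b d y. ?W a c d b y - ?W a c b d y) x = 0"
    using tr_flip[OF x, of "?W a c"] by (simp add: tr_diff)
  \<comment> \<open>exchanging the two contracted pairs brings all terms to the same index pattern in \<open>\<nabla>X\<close>\<close>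
  have K4': "K4 = tr g (\<lambda>b d. tr g (\<lambda>e f y. riem g e a b c y * ?B d f y)) x"
    unfolding K4_def tr_tr_commute[where T = "\<lambda>b d e f y. riem g d a e c y * ?B f b y"]
    by (rule tr_cong) (rule tr_flip[OF x, where T = "\<lambda>d b y. riem g d a _ c y * ?B _ b y"])
  have "K1 a c + K1 c a + K3 + 2 * K4 = tr g (\<lambda>b d. tr g (\<lambda>e f y.
      (riem g a b e c y + riem g c b e a y + riem g c a e b y + 2 * riem g e a b c y) * ?B d f y)) x"
    unfolding K1_def K3_def K4'
    by (simp add: distrib_right tr_add tr_cmult[where r = "\<lambda>_. 2"] mult.assoc tr_add[abs_def] tr_cmult[where r = "\<lambda>_. 2", abs_def])
  also have "\<dots> = tr g (\<lambda>b d. tr g (\<lambda>e f y. 0)) x"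
  proof (rule tr_cong, rule tr_cong)
    fix b d e f
    have "riem g a b e c x + riem g c b e a x + riem g c a e b x + 2 * riem g e a b c x = 0"
      using riem_bianchi1[OF x, of b a e c] riem_bianchi1[OF x, of a b e c]
        riem_antisym_left[of a b e c x] riem_antisym_left[of c b e a x] riem_antisym_right[OF x, of b c e a]
        riem_pair_sym[OF x, of e a b c] riem_pair_sym[OF x, of c a e b] riem_antisym_left[of e b c a x]
        riem_antisym_left[of b c e a x] riem_antisym_left[of c a e b x]
      by linarith
    then show "(riem g a b e c x + riem g c b e a x + riem g c a e b x + 2 * riem g e a b c x) * ?B d f x = 0"
      by simp
  qed
  finally have K: "K1 a c + K1 c a + K3 + 2 * K4 = 0" by (simp add: tr_def)
  have "tr g (\<lambda>b d y. ?W d a b c y + ?W d a c b y + ?W d c a b y + ?W d c b a y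
             - ?W d b a c y - ?W d b c a y - ?W a c b d y - ?W a c d b y) x
     = tr g (\<lambda>b d y. ?W d a b c y - ?W d b a c y) x + tr g (\<lambda>b d y. ?W d c b a y - ?W d b c a y) x
     + tr g (\<lambda>b d y. ?W d c a b y - ?W d a c b y) x
     + 2 * tr g (\<lambda>b d y. ?W d a c b y - ?W a d c b y) x
     + 2 * tr g (\<lambda>b d y. ?W a d c b y - ?W a c d b y) x
     + tr g (\<lambda>b d y. ?W a c d b y - ?W a c b d y) x"
    by (simp add: tr_add tr_diff)
  moreover have "?D p q r x = ?D p r q x" for p q r by (rule covd2_ricci_sym[OF x])
  then have "tr g (\<lambda>e f y. ?D a e c y * X f y) x = tr g (\<lambda>e f y. ?D a c e y * X f y) x"
    "tr g (\<lambda>e f y. ?D c e a y * X f y) x = tr g (\<lambda>e f y. ?D c a e y * X f y) x"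
    "tr g (\<lambda>e f y. ?D e c a y * X f y) x = tr g (\<lambda>e f y. ?D e a c y * X f y) x"
    by (auto intro!: tr_cong)
  ultimately show ?thesis
    using K unfolding P1 P2 P3 P4 P5 by (simp add: left_diff_distrib tr_diff)
qed

section \<open>The equation for the Ricci tensor\<close>

lemma covd2_cong:
  assumes x: "x \<in> U" and "\<And>y a b. y \<in> U \<Longrightarrow> S a b y = T a b y"
  shows "covd2 g S a b c x = covd2 g T a b c x"
proof -
  have "pd a (S b c) x = pd a (T b c) x" by (rule pd_cong[OF open_U x assms(2)])
  then show ?thesis using assms unfolding covd2_def by simp
qed

text \<open>By two applications of \<open>pd_tr\<close> the Hessian of the scalar curvature is a trace of \<open>\<nabla>\<nabla>Ric\<close>, which
  makes it comparable with the trace term of the linearised Ricci tensor.\<close>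
lemma hess_scal_eq_tr:
  assumes x: "x \<in> U"
  shows "hess_scal g a c x = tr g (\<lambda>b d. DDric g a c b d) x"
proof -
  have d: "ricci g b d differentiable (at y)" if "y \<in> U" for b d y
    using differentiable_tens(6)[OF that] .
  have d2: "covd2 g (ricci g) e b d differentiable (at x)" for e b d
    by (rule smooth_on_differentiable[OF _ x]) (intro smooths)
  have 1: "pd c (scal g) y = tr g (covd2 g (ricci g) c) y" if "y \<in> U" for c y
    by (rule pd_tr[OF that d[OF that]])
  have "pd a (pd c (scal g)) x = pd a (tr g (covd2 g (ricci g) c)) x"
    by (rule pd_cong[OF open_U x 1])
  also have "\<dots> = tr g (covd2 g (covd2 g (ricci g) c) a) x"
    by (rule pd_tr[OF x d2])
  finally show ?thesis
    unfolding hess_scal_def covd1_def 1[OF x] DDric_def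
    by (simp add: tr_def covd3_def covd2_def[of g "covd2 g (ricci g) c"] sum_3 algebra_simps)
qed

lemma tensS_eq_tr:
  assumes x: "x \<in> U"
  shows "tensS g c2 lam a c x =
     c2 * (- tr g (\<lambda>e f y. ricci g a e y * ricci g c f y) x
           - tr g (\<lambda>b d. tr g (\<lambda>e f y. riem g d a e c y * ricci g b f y)) x)
     - 2 * lam * ricci g c a x
     + c2 * (tr g (\<lambda>b d. DDric g a d c b) x - tr g (\<lambda>b d. DDric g a c b d) x)
     - c2 * (tr g (\<lambda>b d. DDric g d b a c) x - tr g (\<lambda>b d. DDric g d c a b) x)"
proof -
  have 1: "(\<Sum>e\<in>UNIV. \<Sum>f\<in>UNIV. ginv g e f x * ricci g c f x * ricci g a e x)
      = tr g (\<lambda>e f y. ricci g a e y * ricci g c f y) x"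
    by (simp add: tr_def mult_ac)
  have "(\<Sum>b\<in>UNIV. \<Sum>e\<in>UNIV. \<Sum>p\<in>UNIV. \<Sum>q\<in>UNIV.
                ginv g b p x * ginv g e q x * riem g p c q a x * ricci g b e x)
      = tr g (\<lambda>b p. tr g (\<lambda>e q y. riem g q a p c y * ricci g e b y)) x"
    using riem_pair_sym[OF x, of _ c _ a] ricci_sym[OF x]
    by (simp add: tr_def sum_3 algebra_simps)
  also have "\<dots> = tr g (\<lambda>e q. tr g (\<lambda>b p y. riem g q a p c y * ricci g e b y)) x"
    by (rule tr_tr_commute)
  also have "\<dots> = tr g (\<lambda>b d. tr g (\<lambda>e f y. riem g d a e c y * ricci g b f y)) x"
    by (rule tr_cong) (rule tr_flip[OF x, where T = "\<lambda>p b y. riem g _ a p c y * ricci g _ b y"])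
  finally have 2: "(\<Sum>b\<in>UNIV. \<Sum>e\<in>UNIV. \<Sum>p\<in>UNIV. \<Sum>q\<in>UNIV.
                ginv g b p x * ginv g e q x * riem g p c q a x * ricci g b e x)
      = tr g (\<lambda>b d. tr g (\<lambda>e f y. riem g d a e c y * ricci g b f y)) x" .
  have 3: "(\<Sum>b\<in>UNIV. \<Sum>e\<in>UNIV. ginv g b e x * DDric g a e c b x) = tr g (\<lambda>b d. DDric g a d c b) x"
    by (simp add: tr_def)
  have "(\<Sum>b\<in>UNIV. \<Sum>e\<in>UNIV. ginv g b e x * DDric g b e c a x) = tr g (\<lambda>b d. DDric g b d a c) x"
    unfolding tr_def by (intro sum.cong refl) (simp add: DDric_sym[OF x, of _ _ c a])
  also have "\<dots> = tr g (\<lambda>b d. DDric g d b a c) x"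
    by (rule tr_flip[OF x, symmetric])
  finally have 4: "(\<Sum>b\<in>UNIV. \<Sum>e\<in>UNIV. ginv g b e x * DDric g b e c a x) = tr g (\<lambda>b d. DDric g d b a c) x" .
  have 5: "(\<Sum>b\<in>UNIV. \<Sum>e\<in>UNIV. ginv g b e x * DDric g e c b a x) = tr g (\<lambda>b d. DDric g d c a b) x"
    unfolding tr_def by (intro sum.cong refl) (simp add: DDric_sym[OF x, of _ _ _ a])
  show ?thesis
    unfolding tensS_def 1 2 3 4 5 hess_scal_eq_tr[OF x] ..
qed

text \<open>Commuting \<open>\<nabla>^b\<close> and \<open>\<nabla>_a\<close> on the Ricci tensor is what produces the
  Riemann term in \<open>S\<close>; the term quadratic in the Ricci tensor combines with one from \<open>\<nabla>X\<close>.\<close>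
lemma DDric_commute_tr:
  assumes x: "x \<in> U"
  shows "tr g (\<lambda>b d. DDric g d a b c) x = tr g (\<lambda>b d. DDric g a d c b) x
     + tr g (\<lambda>e f y. ricci g a e y * ricci g c f y) x
     - tr g (\<lambda>b d. tr g (\<lambda>e f y. riem g d a e c y * ricci g b f y)) x"
proof -
  have "tr g (\<lambda>b d. DDric g d a b c) x = tr g (\<lambda>b d y. DDric g a d b c y
      - tr g (\<lambda>e f y. riem g d a e b y * ricci g f c y) y
      - tr g (\<lambda>e f y. riem g d a e c y * ricci g b f y) y) x"
  proof (rule tr_cong)
    fix b d
    show "DDric g d a b c x = DDric g a d b c x
      - tr g (\<lambda>e f y. riem g d a e b y * ricci g f c y) x
      - tr g (\<lambda>e f y. riem g d a e c y * ricci g b f y) x"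
      using ricci_identity_2tensor[where T = "ricci g" and d = d and a = a and b = b and c = c, OF x smooth_ricci] unfolding DDric_def by simp
  qed
  also have "\<dots> = tr g (\<lambda>b d. DDric g a d b c) x
      - tr g (\<lambda>b d. tr g (\<lambda>e f y. riem g d a e b y * ricci g f c y)) x
      - tr g (\<lambda>b d. tr g (\<lambda>e f y. riem g d a e c y * ricci g b f y)) x"
    by (simp add: tr_diff)
  also have "tr g (\<lambda>b d. tr g (\<lambda>e f y. riem g d a e b y * ricci g f c y)) x
      = tr g (\<lambda>e f y. - (ricci g a e y * ricci g c f y)) x"
    unfolding tr_contract_mult[where X = "\<lambda>f. ricci g f c"]
    by (rule tr_cong) (simp add: tr_riem[OF x] ricci_sym[OF x, of _ c])
  also have "tr g (\<lambda>b d. DDric g a d b c) x = tr g (\<lambda>b d. DDric g a d c b) x"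
    by (rule tr_cong) (rule DDric_sym[OF x])
  finally show ?thesis by (simp add: tr_uminus)
qed

lemma lower_ricci:
  assumes x: "x \<in> U"
  shows "tr g (\<lambda>e f y. ricci g c e y * g a f y) x = ricci g c a x"
proof -
  have "tr g (\<lambda>e f y. ricci g c e y * g a f y) x = tr g (\<lambda>e f y. ricci g c e y * g f a y) x"
    by (rule tr_cong) (simp add: sym_g[OF x, of a])
  then show ?thesis by (simp add: tr_g_slot[OF x])
qed

text \<open>Since \<open>\<nabla>g = 0\<close>, the hypothesis turns every symmetrised derivative of \<open>X\<close> in \<open>lie_ricci\<close> into a
  derivative of \<open>2 c\<^sub>2 Ric\<close>. In the two terms where \<open>\<nabla>X\<close> is contracted with the Ricci tensor its
  symmetric part is moved to the right-hand side and becomes part of \<open>S\<close>.\<close>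
lemma soliton_lie_ricci:
  assumes x: "x \<in> U" and X: "\<And>a. smooth_on U (X a)"
    and eq: "\<And>y a b. y \<in> U \<Longrightarrow> 1/2 * (covd1 g X a b y + covd1 g X b a y) - c2 * ricci g a b y = lam * g a b y"
  defines "F \<equiv> \<lambda>a b y. (covd1 g X a b y - covd1 g X b a y) / 2"
  shows "tr g (\<lambda>e f y. covd2 g (ricci g) e a c y * X f y) x
      + tr g (\<lambda>e f y. ricci g c e y * F a f y) x + tr g (\<lambda>e f y. ricci g a e y * F c f y) x
     = tensS g c2 lam a c x"
proof -
  let ?B = "covd1 g X" and ?D = "covd2 g (ricci g)" and ?V = "covd2 g (covd1 g X)" and ?W = "third_covd X"
  have V: "?V a b c y + ?V a c b y = 2 * c2 * ?D a b c y" if y: "y \<in> U" for a b c y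
  proof -
    have dB: "?B a b differentiable (at y)" for a b
      by (rule smooth_on_differentiable[OF _ y]) (intro smooths X)
    have "?V a b c y + ?V a c b y = covd2 g (\<lambda>b c y. ?B b c y + ?B c b y) a b c y"
      unfolding covd2_def by (simp add: pd_add dB sum.distrib algebra_simps)
    also have "\<dots> = covd2 g (\<lambda>b c y. 2 * c2 * ricci g b c y + 2 * lam * g b c y) a b c y"
      using eq by (intro covd2_cong[OF y]) (simp add: field_simps)
    also have "\<dots> = 2 * c2 * ?D a b c y + 2 * lam * covd2 g g a b c y"
      unfolding covd2_def using differentiable_tens[OF y]
      by (simp add: pd_add pd_cmult sum_3 algebra_simps)
    finally show ?thesis by (simp add: covd2_g[OF y])
  qed
  have W: "?W d a b c x + ?W d a c b x = 2 * c2 * DDric g d a b c x" for a b c d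
  proof -
    have dV: "?V a b c differentiable (at x)" "?D a b c differentiable (at x)" for a b c
      by (rule smooth_on_differentiable[OF _ x], intro smooths X)+
    have "?W d a b c x + ?W d a c b x = covd3 g (\<lambda>a b c y. ?V a b c y + ?V a c b y) d a b c x"
      unfolding third_covd_def covd3_def by (simp add: pd_add dV sum.distrib algebra_simps)
    also have "\<dots> = covd3 g (\<lambda>a b c y. 2 * c2 * ?D a b c y) d a b c x"
      by (rule covd3_cong[OF x V])
    also have "\<dots> = 2 * c2 * DDric g d a b c x"
      unfolding covd3_def DDric_def using dV
      by (simp add: pd_cmult sum_3 algebra_simps)
    finally show ?thesis .
  qed
  have "tr g (\<lambda>b d y. ?W d a b c y + ?W d a c b y + ?W d c a b y + ?W d c b a y
             - ?W d b a c y - ?W d b c a y - ?W a c b d y - ?W a c d b y) x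
      = tr g (\<lambda>b d y. (2 * c2) * (DDric g d a b c y + DDric g d c a b y - DDric g d b a c y - DDric g a c b d y)) x"
  proof (rule tr_cong)
    fix b d
    show "?W d a b c x + ?W d a c b x + ?W d c a b x + ?W d c b a x
             - ?W d b a c x - ?W d b c a x - ?W a c b d x - ?W a c d b x
      = (2 * c2) * (DDric g d a b c x + DDric g d c a b x - DDric g d b a c x - DDric g a c b d x)"
      using W[of d a b c] W[of d c a b] W[of d b a c] W[of a c b d] by (simp add: algebra_simps)
  qed
  also have "\<dots> = 2 * c2 * (tr g (\<lambda>b d. DDric g d a b c) x + tr g (\<lambda>b d. DDric g d c a b) x
      - tr g (\<lambda>b d. DDric g d b a c) x - tr g (\<lambda>b d. DDric g a c b d) x)"
    unfolding tr_cmult[where r = "\<lambda>_. 2 * c2"] by (simp add: tr_add tr_diff)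
  finally have L: "c2 * (tr g (\<lambda>b d. DDric g d a b c) x + tr g (\<lambda>b d. DDric g d c a b) x
      - tr g (\<lambda>b d. DDric g d b a c) x - tr g (\<lambda>b d. DDric g a c b d) x)
      = tr g (\<lambda>e f y. ?D e a c y * X f y) x + tr g (\<lambda>e f y. ricci g c e y * ?B a f y) x
        + tr g (\<lambda>e f y. ricci g a e y * ?B c f y) x"
    unfolding lie_ricci[OF x X] by simp
  have B: "tr g (\<lambda>e f y. ricci g c e y * ?B a f y) x = tr g (\<lambda>e f y. ricci g c e y * F a f y) x
      + c2 * tr g (\<lambda>e f y. ricci g c e y * ricci g a f y) x + lam * ricci g c a x" for a c
  proof -
    have "tr g (\<lambda>e f y. ricci g c e y * ?B a f y) x = tr g (\<lambda>e f y. ricci g c e y * F a f y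
        + c2 * (ricci g c e y * ricci g a f y) + lam * (ricci g c e y * g a f y)) x"
    proof (rule tr_cong)
      fix e f
      have "?B a f x = F a f x + c2 * ricci g a f x + lam * g a f x"
        using eq[OF x, of a f] unfolding F_def by (simp add: field_simps)
      then show "ricci g c e x * ?B a f x = ricci g c e x * F a f x
        + c2 * (ricci g c e x * ricci g a f x) + lam * (ricci g c e x * g a f x)"
        by (simp add: algebra_simps)
    qed
    then show ?thesis
      by (simp add: tr_add tr_cmult[where r = "\<lambda>_. c2"] tr_cmult[where r = "\<lambda>_. lam"] lower_ricci[OF x])
  qed
  have RR: "tr g (\<lambda>e f y. ricci g c e y * ricci g a f y) x = tr g (\<lambda>e f y. ricci g a e y * ricci g c f y) x"
    unfolding tr_flip[OF x, where T = "\<lambda>f e y. ricci g a f y * ricci g c e y", symmetric]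
    by (rule tr_cong) simp
  show ?thesis
    using L unfolding B RR tensS_eq_tr[OF x] DDric_commute_tr[OF x]
    using ricci_sym[OF x, of a c] by (simp add: algebra_simps)
qed

end

section \<open>Algebra of the volume form in dimension three\<close>

definition perm_sign :: "3 \<Rightarrow> 3 \<Rightarrow> 3 \<Rightarrow> real" where
  "perm_sign a b c = det (vector [axis a 1, axis b 1, axis c 1] :: real^3^3)"

lemma perm_sign_code:
  "perm_sign a b c = (if (a, b, c) \<in> {(1,2,3), (2,3,1), (3,1,2)} then 1
     else if (a, b, c) \<in> {(1,3,2), (3,2,1), (2,1,3)} then -1 else 0)"
proof -
  have "\<forall>a b c. perm_sign a b c = (if (a, b, c) \<in> {(1,2,3), (2,3,1), (3,1,2)} then 1
     else if (a, b, c) \<in> {(1,3,2), (3,2,1), (2,1,3)} then -1 else 0)"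
    unfolding forall_3 perm_sign_def by (simp add: det_3 axis_def)
  then show ?thesis by blast
qed

lemma perm_sign_det:
  "(\<Sum>i\<in>UNIV. \<Sum>j\<in>UNIV. \<Sum>k\<in>UNIV. G c i * G d j * G b k * perm_sign i j k)
     = det (\<chi> a b. G a b) * perm_sign c d b"
proof -
  have "\<forall>c d b. (\<Sum>i\<in>UNIV. \<Sum>j\<in>UNIV. \<Sum>k\<in>UNIV. G c i * G d j * G b k * perm_sign i j k)
     = det (\<chi> a b. G a b) * perm_sign c d b"
    unfolding forall_3 by (simp add: perm_sign_code sum_3 det_3 algebra_simps)
  then show ?thesis by blast
qed

text \<open>This is where \<open>Q\<close> comes from: on the left is, up to scale, the contraction of two copies of \<open>E\<close> for
  an endomorphism \<open>M\<close>, on the right four times the tensor \<open>Q\<close> built from \<open>M\<close>. It is a polynomial identity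
  in the nine entries, checked for each \<open>b\<close> and \<open>d\<close>.\<close>
lemma perm_sign_contraction:
  fixes M :: "3 \<Rightarrow> 3 \<Rightarrow> real"
  shows "(\<Sum>f\<in>UNIV. \<Sum>k\<in>UNIV.
        (\<Sum>a\<in>UNIV. M a f * perm_sign k a d + M a k * perm_sign f a d)
      * (\<Sum>e\<in>UNIV. M f e * perm_sign k e b + M k e * perm_sign f e b))
    = 4 * ((\<Sum>a\<in>UNIV. \<Sum>c\<in>UNIV. M a c * M c a) * of_bool (b = d)
        + (\<Sum>a\<in>UNIV. M a a) * M b d - 3/2 * (\<Sum>e\<in>UNIV. M b e * M e d)
        - 1/2 * (\<Sum>a\<in>UNIV. M a a)\<^sup>2 * of_bool (b = d))"
proof -
  have "\<forall>b d. (\<Sum>f\<in>UNIV. \<Sum>k\<in>UNIV.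
        (\<Sum>a\<in>UNIV. M a f * perm_sign k a d + M a k * perm_sign f a d)
      * (\<Sum>e\<in>UNIV. M f e * perm_sign k e b + M k e * perm_sign f e b))
    = 4 * ((\<Sum>a\<in>UNIV. \<Sum>c\<in>UNIV. M a c * M c a) * of_bool (b = d)
        + (\<Sum>a\<in>UNIV. M a a) * M b d - 3/2 * (\<Sum>e\<in>UNIV. M b e * M e d)
        - 1/2 * (\<Sum>a\<in>UNIV. M a a)\<^sup>2 * of_bool (b = d))"
    unfolding forall_3 by (simp add: perm_sign_code sum_3 power2_eq_square algebra_simps)
  then show ?thesis by blast
qed

lemma antisym_perm_sign:
  fixes F :: "3 \<Rightarrow> 3 \<Rightarrow> real"
  assumes "\<And>a b. F a b = - F b a"
  shows "F a b = (\<Sum>d\<in>UNIV. perm_sign a b d * (if d = 1 then F 2 3 else if d = 2 then F 3 1 else F 1 2))"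
proof -
  have z: "F a a = 0" for a using assms[of a a] by simp
  have "\<forall>a b. F a b = (\<Sum>d\<in>UNIV. perm_sign a b d * (if d = 1 then F 2 3 else if d = 2 then F 3 1 else F 1 2))"
    unfolding forall_3 using assms[of 2 1] assms[of 3 2] assms[of 1 3] by (simp add: perm_sign_code sum_3 z)
  then show ?thesis by blast
qed

lemma has_signature_det:
  assumes "s = 1 \<or> s = -1" "has_signature s G"
  shows "det G \<noteq> 0" "s * \<bar>det G\<bar> = det G"
proof -
  obtain B :: "real^3^3" where B: "invertible B"
    "transpose B ** G ** B = vector [vector [1, 0, 0], vector [0, 1, 0], vector [0, 0, s]]"
    using assms(2) unfolding has_signature_def by blast
  have "det (transpose B ** G ** B) = s" unfolding B(2) by (simp add: det_3)
  then have e: "(det B)\<^sup>2 * det G = s" by (simp add: det_mul power2_eq_square mult_ac)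
  have p: "(det B)\<^sup>2 > 0" using B(1) by (simp add: invertible_det_nz)
  show "det G \<noteq> 0" using e assms(1) by auto
  show "s * \<bar>det G\<bar> = det G"
  proof (cases "s = 1")
    case True
    then have "(det B)\<^sup>2 * det G > 0" using e by simp
    then have "det G > 0" using p by (rule zero_less_mult_pos)
    then show ?thesis using True by simp
  next
    case False
    then have "(det B)\<^sup>2 * det G < 0" using e assms(1) by simp
    then have "det G < 0" using p by (simp add: mult_less_0_iff)
    then show ?thesis using False assms(1) by simp
  qed
qed

context chart_metric begin

lemma ricci_schouten:
  assumes x: "x \<in> U"
  shows "ricci g c d x = schouten g c d x + tr g (schouten g) x * g c d x"
proof -
  from theI'[OF schouten_existence_unique[where g = g, OF inv_g[OF x] sym_g[OF x]], rule_format]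
  show ?thesis unfolding schouten_def tr_def .
qed

lemma schouten_sym: "x \<in> U \<Longrightarrow> schouten g a b x = schouten g b a x"
  using ricci_schouten[of x a b] ricci_schouten[of x b a] ricci_sym[of x a b] sym_g[of x a b] by simp

lemma tensE_eq:
  "tensE g c d b x = sqrt \<bar>det (mat_at g x)\<bar> / 2 *
     (\<Sum>a\<in>UNIV. mixed g (schouten g) a c x * perm_sign d a b + mixed g (schouten g) a d x * perm_sign c a b)"
  unfolding tensE_def volform_def perm_sign_def
  by (simp add: sum_3 algebra_simps)

lemma tensE_sym: "tensE g c d b x = tensE g d c b x"
  unfolding tensE_def by simp

lemma det_ginv:
  assumes x: "x \<in> U"
  shows "det (mat_at g x) * det (\<chi> a b. ginv g a b x) = 1"
proof -
  have "mat_at g x ** (\<chi> a b. ginv g a b x) = mat 1"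
    using g_ginv[OF x] by (simp add: vec_eq_iff matrix_matrix_mult_def mat_def mat_at_def)
  then show ?thesis by (metis det_I det_mul)
qed

text \<open>Raising the indices of the volume form multiplies it by the determinant of the inverse metric.
  As the Schouten tensor is symmetric, raising the lower index of \<open>P^a_c\<close> and lowering the upper
  one only exchanges the roles of the two indices.\<close>
lemma tensE_raised_eq:
  assumes x: "x \<in> U"
  shows "tensE_raised g c d b x = sqrt \<bar>det (mat_at g x)\<bar> / (2 * det (mat_at g x)) *
     (\<Sum>e\<in>UNIV. mixed g (schouten g) c e x * perm_sign d e b + mixed g (schouten g) d e x * perm_sign c e b)"
proof -
  let ?M = "\<lambda>a b. mixed g (schouten g) a b x" and ?G = "\<lambda>a b. ginv g a b x"
  let ?r = "sqrt \<bar>det (mat_at g x)\<bar>" and ?dG = "det (\<chi> a b. ginv g a b x)"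
  have M: "(\<Sum>i\<in>UNIV. ?G c i * ?M a i) = (\<Sum>e\<in>UNIV. ?M c e * ?G e a)" for a c
    unfolding mixed_def
    by (simp add: sum_3 ginv_sym[OF x, of _ a] schouten_sym[OF x, of 2 1] schouten_sym[OF x, of 3 1]
       schouten_sym[OF x, of 3 2] algebra_simps)
  have half: "(\<Sum>i\<in>UNIV. \<Sum>j\<in>UNIV. \<Sum>k\<in>UNIV. ?G c i * ?G d j * ?G b k * (\<Sum>a\<in>UNIV. ?M a i * perm_sign j a k))
      = ?dG * (\<Sum>e\<in>UNIV. ?M c e * perm_sign d e b)" for c d
  proof -
    have "(\<Sum>i\<in>UNIV. \<Sum>j\<in>UNIV. \<Sum>k\<in>UNIV. ?G c i * ?G d j * ?G b k * (\<Sum>a\<in>UNIV. ?M a i * perm_sign j a k))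
      = (\<Sum>a\<in>UNIV. (\<Sum>i\<in>UNIV. ?G c i * ?M a i) * (\<Sum>j\<in>UNIV. \<Sum>k\<in>UNIV. ?G d j * ?G b k * perm_sign j a k))"
      by (simp add: sum_3 algebra_simps)
    also have "\<dots> = (\<Sum>e\<in>UNIV. ?M c e * (\<Sum>j\<in>UNIV. \<Sum>a\<in>UNIV. \<Sum>k\<in>UNIV. ?G d j * ?G e a * ?G b k * perm_sign j a k))"
      unfolding M by (simp add: sum_3 algebra_simps)
    finally show ?thesis
      unfolding perm_sign_det[of ?G] by (simp add: sum_distrib_left mult_ac)
  qed
  have "tensE_raised g c d b x = ?r / 2 *
      ((\<Sum>i\<in>UNIV. \<Sum>j\<in>UNIV. \<Sum>k\<in>UNIV. ?G c i * ?G d j * ?G b k * (\<Sum>a\<in>UNIV. ?M a i * perm_sign j a k))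
     + (\<Sum>j\<in>UNIV. \<Sum>i\<in>UNIV. \<Sum>k\<in>UNIV. ?G d j * ?G c i * ?G b k * (\<Sum>a\<in>UNIV. ?M a j * perm_sign i a k)))"
    unfolding tensE_raised_def tensE_eq sum.distrib
    unfolding sum.swap[of "\<lambda>j i. \<Sum>k\<in>UNIV. ?G d j * ?G c i * ?G b k * (\<Sum>a\<in>UNIV. ?M a j * perm_sign i a k)"]
    by (simp add: sum.distrib[symmetric] sum_distrib_left distrib_left mult_ac)
  also have "\<dots> = ?r / 2 * ?dG *
     (\<Sum>e\<in>UNIV. ?M c e * perm_sign d e b + ?M d e * perm_sign c e b)"
    unfolding half by (simp add: sum.distrib algebra_simps)
  also have "?dG = 1 / det (mat_at g x)"
    using det_ginv[OF x] by (metis mult_zero_left nonzero_eq_divide_eq mult.commute zero_neq_one)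
  finally show ?thesis by simp
qed

lemma tensQ_eq:
  assumes x: "x \<in> U"
  defines "M \<equiv> \<lambda>a b. mixed g (schouten g) a b x"
  shows "tensQ g b d x = (\<Sum>a\<in>UNIV. \<Sum>c\<in>UNIV. M a c * M c a) * of_bool (b = d)
        + (\<Sum>a\<in>UNIV. M a a) * M b d - 3/2 * (\<Sum>e\<in>UNIV. M b e * M e d)
        - 1/2 * (\<Sum>a\<in>UNIV. M a a)\<^sup>2 * of_bool (b = d)"
proof -
  note S = schouten_sym[OF x, of 2 1] schouten_sym[OF x, of 3 1] schouten_sym[OF x, of 3 2]
    schouten_sym[OF x, of d]
    ginv_sym[OF x, of 2 1] ginv_sym[OF x, of 3 1] ginv_sym[OF x, of 3 2]
  have 1: "(\<Sum>a\<in>UNIV. \<Sum>c\<in>UNIV. schouten g a c x * raised g (schouten g) a c x)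
      = (\<Sum>a\<in>UNIV. \<Sum>c\<in>UNIV. M a c * M c a)"
    unfolding M_def mixed_def raised_def by (simp add: sum_3 S algebra_simps)
  have 2: "tr g (schouten g) x = (\<Sum>a\<in>UNIV. M a a)"
    unfolding M_def mixed_def tr_def by (simp add: sum_3 S algebra_simps)
  have 3: "(\<Sum>e\<in>UNIV. raised g (schouten g) b e x * schouten g d e x) = (\<Sum>e\<in>UNIV. M b e * M e d)"
    unfolding M_def mixed_def raised_def by (simp add: sum_3 S algebra_simps)
  show ?thesis unfolding tensQ_def 1 2 3 M_def ..
qed

text \<open>The volume factors of the two copies of \<open>E\<close> combine to \<open>\<bar>det g\<bar> / det g\<close>, which is the
  sign \<open>s\<close> of the signature.\<close>
lemma tensE_contraction:
  assumes x: "x \<in> U" and s: "s * \<bar>det (mat_at g x)\<bar> = det (mat_at g x)"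
  shows "(\<Sum>f\<in>UNIV. \<Sum>k\<in>UNIV. tensE g f k d x * tensE_raised g f k b x) = s * tensQ g b d x"
proof -
  let ?D = "det (mat_at g x)" and ?M = "\<lambda>a b. mixed g (schouten g) a b x"
  have nz: "?D \<noteq> 0" using det_ginv[OF x] by auto
  have "sqrt \<bar>?D\<bar> / 2 * (sqrt \<bar>?D\<bar> / (2 * ?D)) = \<bar>?D\<bar> / (4 * ?D)"
    by (simp add: field_simps)
  also have "\<dots> = s / 4"
  proof -
    have "s * ?D = \<bar>?D\<bar>" using s by (cases "?D > 0") simp_all
    then show ?thesis using nz by (simp add: field_simps)
  qed
  finally have r: "sqrt \<bar>?D\<bar> / 2 * (sqrt \<bar>?D\<bar> / (2 * ?D)) = s / 4" .
  have "(\<Sum>f\<in>UNIV. \<Sum>k\<in>UNIV. tensE g f k d x * tensE_raised g f k b x)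
     = (\<Sum>f\<in>UNIV. \<Sum>k\<in>UNIV. (sqrt \<bar>?D\<bar> / 2 * (sqrt \<bar>?D\<bar> / (2 * ?D))) *
        ((\<Sum>a\<in>UNIV. ?M a f * perm_sign k a d + ?M a k * perm_sign f a d)
      * (\<Sum>e\<in>UNIV. ?M f e * perm_sign k e b + ?M k e * perm_sign f e b)))"
    unfolding tensE_eq tensE_raised_eq[OF x] by (simp only: mult_ac)
  also have "\<dots> = s / 4 * (\<Sum>f\<in>UNIV. \<Sum>k\<in>UNIV.
        ((\<Sum>a\<in>UNIV. ?M a f * perm_sign k a d + ?M a k * perm_sign f a d)
      * (\<Sum>e\<in>UNIV. ?M f e * perm_sign k e b + ?M k e * perm_sign f e b)))"
    unfolding r by (simp only: sum_distrib_left)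
  also have "\<dots> = s / 4 * (4 * tensQ g b d x)"
    unfolding perm_sign_contraction tensQ_eq[OF x] ..
  finally show ?thesis by simp
qed

text \<open>Here \<open>F_ab\<close> is replaced by its dual vector. The multiple of \<open>g\<close> in the Ricci tensor contributes
  \<open>F_ac + F_ca = 0\<close>, so only the Schouten tensor remains, as in the definition of \<open>E\<close>. The factor
  \<open>2 / sqrt \<bar>det g\<bar>\<close> in the witness undoes the symmetrisation and the density in \<open>E\<close>.\<close>
lemma rotation_ricci:
  assumes x: "x \<in> U" and F: "\<And>a b. F a b x = - F b a x"
  shows "\<exists>w. \<forall>a c. tr g (\<lambda>e f y. ricci g c e y * F a f y) x + tr g (\<lambda>e f y. ricci g a e y * F c f y) x
      = (\<Sum>d\<in>UNIV. tensE g c a d x * w d)"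
proof -
  let ?M = "\<lambda>a b. mixed g (schouten g) a b x" and ?r = "sqrt \<bar>det (mat_at g x)\<bar>"
  define v where "v d = (if d = 1 then F 2 3 x else if d = 2 then F 3 1 x else F 1 2 x)" for d :: 3
  have nz: "?r \<noteq> 0" using det_ginv[OF x] by auto
  have Fv: "F a b x = (\<Sum>d\<in>UNIV. perm_sign a b d * v d)" for a b
    unfolding v_def by (rule antisym_perm_sign[of "\<lambda>a b. F a b x"]) (rule F)
  have R: "tr g (\<lambda>e f y. ricci g c e y * F a f y) x
      = (\<Sum>f\<in>UNIV. ?M f c * F a f x) + tr g (schouten g) x * F a c x" for a c
  proof -
    have "tr g (\<lambda>e f y. ricci g c e y * F a f y) x
        = (\<Sum>f\<in>UNIV. (\<Sum>e\<in>UNIV. ginv g f e x * ricci g e c x) * F a f x)"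
      by (simp add: tr_def sum_3 ricci_sym[OF x, of c] ginv_sym[OF x, of 2 1] ginv_sym[OF x, of 3 1]
        ginv_sym[OF x, of 3 2] algebra_simps)
    also have "\<dots> = (\<Sum>f\<in>UNIV. ?M f c * F a f x
        + (if f = c then tr g (schouten g) x * F a c x else 0))"
    proof (rule sum.cong[OF refl])
      fix f
      have "(\<Sum>e\<in>UNIV. ginv g f e x * ricci g e c x)
          = ?M f c + tr g (schouten g) x * (if f = c then 1 else 0)"
        unfolding ricci_schouten[OF x] ginv_g[OF x, symmetric] mixed_def
        by (simp add: sum_3 algebra_simps)
      then show "(\<Sum>e\<in>UNIV. ginv g f e x * ricci g e c x) * F a f x
          = ?M f c * F a f x + (if f = c then tr g (schouten g) x * F a c x else 0)"
        by (simp add: distrib_right)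
    qed
    finally show ?thesis by (simp add: sum.distrib)
  qed
  have "tr g (\<lambda>e f y. ricci g c e y * F a f y) x + tr g (\<lambda>e f y. ricci g a e y * F c f y) x
      = (\<Sum>d\<in>UNIV. tensE g c a d x * (2 / ?r * v d))" for a c
  proof -
    have "tr g (\<lambda>e f y. ricci g c e y * F a f y) x + tr g (\<lambda>e f y. ricci g a e y * F c f y) x
        = (\<Sum>f\<in>UNIV. ?M f c * F a f x) + (\<Sum>f\<in>UNIV. ?M f a * F c f x)"
      unfolding R F[of c a] by simp
    also have "\<dots> = (\<Sum>d\<in>UNIV. (\<Sum>f\<in>UNIV. ?M f c * perm_sign a f d + ?M f a * perm_sign c f d) * v d)"
      unfolding Fv by (simp add: sum_3 algebra_simps)
    also have "\<dots> = (\<Sum>d\<in>UNIV. tensE g c a d x * (2 / ?r * v d))"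
      unfolding tensE_eq using nz by simp
    finally show ?thesis .
  qed
  then show ?thesis by (intro exI[of _ "\<lambda>d. 2 / ?r * v d"] allI)
qed

text \<open>The difference of the two sides is linear in \<open>S - v = E w\<close>. Contracting \<open>E w\<close> with the raised
  \<open>E\<close> gives \<open>s Q w\<close>, the inverse of \<open>Q\<close> returns \<open>s w\<close>, and \<open>s\<^sup>2 = 1\<close>.\<close>
lemma eliminate_rotation:
  fixes v S :: "3 \<Rightarrow> 3 \<Rightarrow> real"
  assumes x: "x \<in> U" and s: "s = 1 \<or> s = -1" "s * \<bar>det (mat_at g x)\<bar> = det (mat_at g x)"
    and Q: "det (mat_at (tensQ g) x) \<noteq> 0"
    and w: "\<And>a c. v a c + (\<Sum>d\<in>UNIV. tensE g c a d x * w d) = S a c"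
  shows "v a c - s * (\<Sum>d\<in>UNIV. tensE g c a d x * (\<Sum>b\<in>UNIV. tensQ_inv g d b x *
           (\<Sum>f\<in>UNIV. \<Sum>k\<in>UNIV. v f k * tensE_raised g f k b x)))
       = S a c - s * (\<Sum>d\<in>UNIV. tensE g c a d x * (\<Sum>b\<in>UNIV. tensQ_inv g d b x *
           (\<Sum>f\<in>UNIV. \<Sum>k\<in>UNIV. S f k * tensE_raised g f k b x)))"
proof -
  have "invertible (mat_at (tensQ g) x)" using Q by (simp add: invertible_det_nz)
  then have "matrix_inv (mat_at (tensQ g) x) ** mat_at (tensQ g) x = mat 1"
    using someI_ex[of "\<lambda>B. mat_at (tensQ g) x ** B = mat 1 \<and> B ** mat_at (tensQ g) x = mat 1"]
    unfolding invertible_def matrix_inv_def by blast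
  then have QQ: "(\<Sum>b\<in>UNIV. tensQ_inv g d b x * tensQ g b h x) = (if d = h then 1 else 0)" for d h
    unfolding vec_eq_iff matrix_matrix_mult_def by (simp add: mat_def tensQ_inv_def mat_at_def)
  let ?C = "\<lambda>T b. (\<Sum>f\<in>UNIV. \<Sum>k\<in>UNIV. T f k * tensE_raised g f k b x)"
  have C: "?C S b - ?C v b = (\<Sum>h\<in>UNIV. s * tensQ g b h x * w h)" for b
  proof -
    have "?C S b - ?C v b = (\<Sum>f\<in>UNIV. \<Sum>k\<in>UNIV. (\<Sum>d\<in>UNIV. tensE g f k d x * w d) * tensE_raised g f k b x)"
    proof -
      have "S f k - v f k = (\<Sum>d\<in>UNIV. tensE g f k d x * w d)" for f k
        using w[of f k] by (simp add: tensE_sym[of k f])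
      then show ?thesis by (simp add: sum_subtractf[symmetric] left_diff_distrib[symmetric])
    qed
    also have "\<dots> = (\<Sum>h\<in>UNIV. (\<Sum>f\<in>UNIV. \<Sum>k\<in>UNIV. tensE g f k h x * tensE_raised g f k b x) * w h)"
      by (simp add: sum_3 algebra_simps)
    finally show ?thesis unfolding tensE_contraction[OF x s(2)] .
  qed
  have "(\<Sum>b\<in>UNIV. tensQ_inv g d b x * ?C S b) - (\<Sum>b\<in>UNIV. tensQ_inv g d b x * ?C v b) = s * w d" for d
  proof -
    have "(\<Sum>b\<in>UNIV. tensQ_inv g d b x * ?C S b) - (\<Sum>b\<in>UNIV. tensQ_inv g d b x * ?C v b)
        = (\<Sum>b\<in>UNIV. tensQ_inv g d b x * (?C S b - ?C v b))"
      by (simp only: sum_subtractf right_diff_distrib)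
    also have "\<dots> = (\<Sum>h\<in>UNIV. s * ((\<Sum>b\<in>UNIV. tensQ_inv g d b x * tensQ g b h x) * w h))"
      unfolding C by (simp add: sum_3 algebra_simps)
    finally show ?thesis unfolding QQ by (simp add: if_distrib if_distribR cong: if_cong)
  qed
  then have "(\<Sum>b\<in>UNIV. tensQ_inv g d b x * ?C S b) = (\<Sum>b\<in>UNIV. tensQ_inv g d b x * ?C v b) + s * w d" for d
    by (simp add: algebra_simps)
  moreover have sE: "s * (\<Sum>d\<in>UNIV. tensE g c a d x * (s * w d)) = (\<Sum>d\<in>UNIV. tensE g c a d x * w d)"
    using s(1) by (auto simp: sum_negf)
  ultimately show ?thesis
    unfolding w[of a c, symmetric]
    by (simp add: distrib_left sum.distrib sE)
qed

end

section \<open>The equation without the unknown rotation\<close>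

lemma regroup_contraction:
  fixes T :: "3 \<Rightarrow> 3 \<Rightarrow> real"
    and E :: "3 \<Rightarrow> real" and Q :: "3 \<Rightarrow> 3 \<Rightarrow> real" and R :: "3 \<Rightarrow> 3 \<Rightarrow> 3 \<Rightarrow> real"
  shows "(\<Sum>f\<in>UNIV. \<Sum>k\<in>UNIV. \<Sum>d\<in>UNIV. \<Sum>b\<in>UNIV. E d * Q d b * T f k * R f k b)
    = (\<Sum>d\<in>UNIV. E d * (\<Sum>b\<in>UNIV. Q d b * (\<Sum>f\<in>UNIV. \<Sum>k\<in>UNIV. T f k * R f k b)))"
  by (simp add: sum_3 algebra_simps)

lemma regroup_directional_contraction:
  fixes D :: "3 \<Rightarrow> 3 \<Rightarrow> 3 \<Rightarrow> real" and Y :: "3 \<Rightarrow> real"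
    and E :: "3 \<Rightarrow> real" and Q :: "3 \<Rightarrow> 3 \<Rightarrow> real" and R :: "3 \<Rightarrow> 3 \<Rightarrow> 3 \<Rightarrow> real"
  shows "(\<Sum>e\<in>UNIV. Y e * (D e a c - s * (\<Sum>f\<in>UNIV. \<Sum>k\<in>UNIV. \<Sum>d\<in>UNIV. \<Sum>b\<in>UNIV.
        D e f k * E d * Q d b * R f k b)))
    = (\<Sum>e\<in>UNIV. Y e * D e a c) - s * (\<Sum>d\<in>UNIV. E d * (\<Sum>b\<in>UNIV. Q d b *
        (\<Sum>f\<in>UNIV. \<Sum>k\<in>UNIV. (\<Sum>e\<in>UNIV. Y e * D e f k) * R f k b)))"
proof -
  have "(\<Sum>f\<in>UNIV. \<Sum>k\<in>UNIV. \<Sum>d\<in>UNIV. \<Sum>b\<in>UNIV. D e f k * E d * Q d b * R f k b)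
      = (\<Sum>d\<in>UNIV. E d * (\<Sum>b\<in>UNIV. Q d b * (\<Sum>f\<in>UNIV. \<Sum>k\<in>UNIV. D e f k * R f k b)))" for e
    unfolding regroup_contraction[symmetric] by (simp only: mult_ac)
  moreover have "(\<Sum>d\<in>UNIV. E d * (\<Sum>b\<in>UNIV. Q d b * (\<Sum>f\<in>UNIV. \<Sum>k\<in>UNIV. T f k * R f k b)))
      = (\<Sum>f\<in>UNIV. \<Sum>k\<in>UNIV. T f k * K f k)" if "K = (\<lambda>f k. \<Sum>d\<in>UNIV. \<Sum>b\<in>UNIV. E d * Q d b * R f k b)"
    for T K :: "3 \<Rightarrow> 3 \<Rightarrow> real"
    unfolding regroup_contraction[symmetric] that by (simp add: sum_distrib_left mult_ac)
  note this[OF refl]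
  moreover have "(\<Sum>e\<in>UNIV. Y e * (D e a c - s * (\<Sum>f\<in>UNIV. \<Sum>k\<in>UNIV. D e f k * K f k)))
     = (\<Sum>e\<in>UNIV. Y e * D e a c) - s * (\<Sum>f\<in>UNIV. \<Sum>k\<in>UNIV. (\<Sum>e\<in>UNIV. Y e * D e f k) * K f k)"
    for K by (simp add: sum_3 algebra_simps)
  ultimately show ?thesis by simp
qed

theorem proposition5p1:
  fixes M :: "'a topology" and A :: "'a chart set"
    and g :: "'a chart \<Rightarrow> tens2" and X :: "'a chart \<Rightarrow> tens1"
    and s c\<^sub>2 lam :: real
  assumes "oriented_3manifold M A"
    and "s = 1 \<or> s = -1"
    and "metric A s g"
    and "\<forall>u\<in>A. \<forall>x\<in>coord_range u. det (mat_at (tensQ (g u)) x) \<noteq> 0"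
    and "one_form A X"
    and "\<forall>u\<in>A. \<forall>x\<in>coord_range u. \<forall>a b.
           1/2 * (covd1 (g u) (X u) a b x + covd1 (g u) (X u) b a x) - c\<^sub>2 * ricci (g u) a b x
           = lam * g u a b x"
  shows "\<forall>u\<in>A. \<forall>x\<in>coord_range u. \<forall>a c.
    (\<Sum>e\<in>UNIV. (\<Sum>h\<in>UNIV. ginv (g u) e h x * X u h x) *
       (covd2 (g u) (ricci (g u)) e a c x
        - s * (\<Sum>f\<in>UNIV. \<Sum>k\<in>UNIV. \<Sum>d\<in>UNIV. \<Sum>b\<in>UNIV.
            covd2 (g u) (ricci (g u)) e f k x * tensE (g u) c a d x
            * tensQ_inv (g u) d b x * tensE_raised (g u) f k b x)))
    = tensS (g u) c\<^sub>2 lam a c x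
      - s * (\<Sum>f\<in>UNIV. \<Sum>k\<in>UNIV. \<Sum>d\<in>UNIV. \<Sum>b\<in>UNIV.
          tensE (g u) c a d x * tensQ_inv (g u) d b x
          * tensS (g u) c\<^sub>2 lam f k x * tensE_raised (g u) f k b x)"
proof (intro ballI allI)
  fix u x a c
  assume u: "u \<in> A" and x: "x \<in> coord_range u"
  have sig: "has_signature s (mat_at (g u) y)" if "y \<in> coord_range u" for y
    using assms(3)[unfolded metric_def, THEN conjunct2] u that by blast
  interpret chart_metric "coord_range u" "g u"
  proof
    show "open (coord_range u)"
      using assms(1)[unfolded oriented_3manifold_def is_chart_def, THEN conjunct2, THEN conjunct2,
          THEN conjunct1] u by blast
    show "smooth_on (coord_range u) (g u a b)" for a b
      using assms(3)[unfolded metric_def covariant_2tensor_def, THEN conjunct1, THEN conjunct1] u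
      by blast
    show "g u a b y = g u b a y" if "y \<in> coord_range u" for a b y
      using assms(3)[unfolded metric_def, THEN conjunct2] u that by blast
    show "invertible (mat_at (g u) y)" if "y \<in> coord_range u" for y
      using has_signature_det(1)[OF assms(2) sig[OF that]] by (simp add: invertible_det_nz)
  qed
  have X: "smooth_on (coord_range u) (X u b)" for b
    using assms(5)[unfolded one_form_def, THEN conjunct1] u by blast
  \<comment> \<open>the rotation part of \<open>\<nabla>X\<close>, to be eliminated\<close>
  define F where "F a b y = (covd1 (g u) (X u) a b y - covd1 (g u) (X u) b a y) / 2" for a b y
  have "F p q x = - F q p x" for p q unfolding F_def by (simp add: field_simps)
  \<comment> \<open>its contribution is linear in an unknown \<open>w\<close> whose coefficients are the components of \<open>E\<close>\<close>
  from rotation_ricci[where F = F, OF x this] obtain w where w: "\<And>a c.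
      tr (g u) (\<lambda>e f y. ricci (g u) c e y * F a f y) x + tr (g u) (\<lambda>e f y. ricci (g u) a e y * F c f y) x
      = (\<Sum>d\<in>UNIV. tensE (g u) c a d x * w d)" by blast
  define Y where "Y e = (\<Sum>h\<in>UNIV. ginv (g u) e h x * X u h x)" for e
  define v where "v a c = (\<Sum>e\<in>UNIV. Y e * covd2 (g u) (ricci (g u)) e a c x)" for a c
  have vw: "v a c + (\<Sum>d\<in>UNIV. tensE (g u) c a d x * w d) = tensS (g u) c\<^sub>2 lam a c x" for a c
  proof -
    have "tr (g u) (\<lambda>e f y. covd2 (g u) (ricci (g u)) e a c y * X u f y) x = v a c"
      unfolding v_def Y_def tr_def by (simp add: sum_distrib_left sum_distrib_right mult_ac)
    moreover have "1/2 * (covd1 (g u) (X u) a b y + covd1 (g u) (X u) b a y) - c\<^sub>2 * ricci (g u) a b y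
           = lam * g u a b y" if "y \<in> coord_range u" for a b y
      using assms(6) u that by blast
    ultimately show ?thesis
      using soliton_lie_ricci[where X = "X u" and ?c2.0 = c\<^sub>2 and lam = lam and a = a and c = c, OF x X] unfolding F_def[symmetric] w[symmetric] by simp
  qed
  have "(\<Sum>e\<in>UNIV. Y e * (covd2 (g u) (ricci (g u)) e a c x
        - s * (\<Sum>f\<in>UNIV. \<Sum>k\<in>UNIV. \<Sum>d\<in>UNIV. \<Sum>b\<in>UNIV.
            covd2 (g u) (ricci (g u)) e f k x * tensE (g u) c a d x
            * tensQ_inv (g u) d b x * tensE_raised (g u) f k b x)))
    = v a c - s * (\<Sum>d\<in>UNIV. tensE (g u) c a d x * (\<Sum>b\<in>UNIV. tensQ_inv (g u) d b x *
           (\<Sum>f\<in>UNIV. \<Sum>k\<in>UNIV. v f k * tensE_raised (g u) f k b x)))"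
    unfolding v_def by (rule regroup_directional_contraction)
  also have "\<dots> = tensS (g u) c\<^sub>2 lam a c x - s * (\<Sum>d\<in>UNIV. tensE (g u) c a d x * (\<Sum>b\<in>UNIV. tensQ_inv (g u) d b x *
           (\<Sum>f\<in>UNIV. \<Sum>k\<in>UNIV. tensS (g u) c\<^sub>2 lam f k x * tensE_raised (g u) f k b x)))"
    by (rule eliminate_rotation[OF x assms(2) has_signature_det(2)[OF assms(2) sig[OF x]] _ vw])
      (use assms(4) u x in blast)
  finally show "(\<Sum>e\<in>UNIV. (\<Sum>h\<in>UNIV. ginv (g u) e h x * X u h x) *
       (covd2 (g u) (ricci (g u)) e a c x
        - s * (\<Sum>f\<in>UNIV. \<Sum>k\<in>UNIV. \<Sum>d\<in>UNIV. \<Sum>b\<in>UNIV.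
            covd2 (g u) (ricci (g u)) e f k x * tensE (g u) c a d x
            * tensQ_inv (g u) d b x * tensE_raised (g u) f k b x)))
    = tensS (g u) c\<^sub>2 lam a c x
      - s * (\<Sum>f\<in>UNIV. \<Sum>k\<in>UNIV. \<Sum>d\<in>UNIV. \<Sum>b\<in>UNIV.
          tensE (g u) c a d x * tensQ_inv (g u) d b x
          * tensS (g u) c\<^sub>2 lam f k x * tensE_raised (g u) f k b x)"
    unfolding regroup_contraction Y_def .
qed

end
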